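(* Let $G$ be a finite 3-connected graph, $G'$ a graph, and $f:G\rightarrow G'$ a circuit surjection. Then $f$ is induced by a vertex isomorphism, i.e. there is a bijection $\varphi:V(G)\to V(G')$ such that $f(uv)=\varphi(u)\varphi(v)$ for every edge $uv$ of $G$ (in particular $G\cong G'$).
   Context: Graphs are undirected, without loops or multiple edges. A circuit surjection $f:G\rightarrow G'$ is a map from $E(G)$ onto $E(G')$ such that for every circuit $C$ of $G$, $f(C)$ is a circuit of $G'$; $G'$ is required to have no isolated vertices. *)

theory Defs
  imports Main
begin

text \<open>A (simple, undirected, loopless) graph is given by a vertex set V and an edge set E
  whose elements are 2-element subsets of V.\<close>
definition simple_graph :: "'a set \<Rightarrow> 'a set set \<Rightarrow> bool" where
  "simple_graph V E \<longleftrightarrow> (\<forall>e\<in>E. \<exists>u v. e = {u, v} \<and> u \<noteq> v \<and> u \<in> V \<and> v \<in> V)"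

text \<open>Edge set of the cycle through the (distinct) vertices of the list, in order.\<close>
definition cycle_edges :: "'a list \<Rightarrow> 'a set set" where
  "cycle_edges vs = {{vs ! i, vs ! ((i + 1) mod length vs)} | i. i < length vs}"

text \<open>A circuit of the graph (V,E): the edge set of a cycle (length at least 3).\<close>
definition is_circuit :: "'a set \<Rightarrow> 'a set set \<Rightarrow> 'a set set \<Rightarrow> bool" where
  "is_circuit V E C \<longleftrightarrow>
     (\<exists>vs. length vs \<ge> 3 \<and> distinct vs \<and> set vs \<subseteq> V \<and> cycle_edges vs \<subseteq> E \<and> C = cycle_edges vs)"

definition graph_connected :: "'a set \<Rightarrow> 'a set set \<Rightarrow> bool" where
  "graph_connected V E \<longleftrightarrow> V \<noteq> {} \<and>
     (\<forall>u\<in>V. \<forall>v\<in>V. (u, v) \<in> {(x, y). {x, y} \<in> E}\<^sup>*)"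

text \<open>Deleting a vertex set S.\<close>
definition del_verts_E :: "'a set set \<Rightarrow> 'a set \<Rightarrow> 'a set set" where
  "del_verts_E E S = {e \<in> E. e \<inter> S = {}}"

text \<open>k-connected: more than k vertices, and removing fewer than k vertices leaves it connected.\<close>
definition k_connected :: "nat \<Rightarrow> 'a set \<Rightarrow> 'a set set \<Rightarrow> bool" where
  "k_connected k V E \<longleftrightarrow> card V > k \<and>
     (\<forall>S. S \<subseteq> V \<longrightarrow> finite S \<longrightarrow> card S < k \<longrightarrow> graph_connected (V - S) (del_verts_E E S))"

definition no_isolated_vertices :: "'a set \<Rightarrow> 'a set set \<Rightarrow> bool" where
  "no_isolated_vertices V E \<longleftrightarrow> (\<forall>v\<in>V. \<exists>e\<in>E. v \<in> e)"

text \<open>Circuit surjection f : (V,E) \<rightarrow> (V',E'): maps E onto E', circuits to circuits.\<close>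
definition circuit_surjection ::
  "'a set \<Rightarrow> 'a set set \<Rightarrow> 'b set \<Rightarrow> 'b set set \<Rightarrow> ('a set \<Rightarrow> 'b set) \<Rightarrow> bool" where
  "circuit_surjection V E V' E' f \<longleftrightarrow>
     f ` E = E' \<and> (\<forall>C. is_circuit V E C \<longrightarrow> is_circuit V' E' (f ` C))"

end

theory Submission
  imports Defs
begin

text \<open>The map \<open>f\<close> is injective: if the three circuits of a theta graph have distinct images, then the
  images of its three paths are disjoint, so two edges with the same image can only be separated by
  theta graphs that collapse to one circuit. Given \<open>f e = f e'\<close> and a circuit through both edges, an ear
  whose image leaves the image of the circuit leads to a theta graph with \<open>e\<close> and \<open>e'\<close> on the same path;
  3-connectivity supplies a further path separating them, a contradiction. If there is no such ear, then
  \<open>G'\<close> is a circuit, all sets \<open>{e. f e \<noteq> a}\<close> are forests, and counting edges contradicts minimum degree 3.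

  For injective \<open>f\<close>, cuts of \<open>G'\<close> pull back to cuts of \<open>G\<close>, and a star pulls back to a cut meeting
  every circuit in at most two edges. By 3-connectivity such a cut is a star or has at most three edges.
  Comparing degree sums, \<open>G'\<close> has at least as many vertices as \<open>G\<close>, so counting shows that every cut of \<open>G\<close>
  is the preimage of a cut of \<open>G'\<close>. As \<open>G - v\<close> is 2-connected, the star of \<open>v\<close> must then be the preimage
  of a star, as in Whitney's theorem; its centre is the image of \<open>v\<close>.\<close>

section \<open>Paths and Menger's theorem for two paths\<close>

text \<open>Information flows one way: circuits have circuits as images, but nothing is known about
  preimages of circuits, so the two graphs cannot be treated as having the same circuits even once
  \<open>f\<close> is injective. What does transfer is parity. Cuts are exactly the edge sets that
  meet every circuit evenly, and an injective \<open>f\<close> preserves the number of edges in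
  which a circuit meets a set; this is why cuts pull back, and why the opposite direction has to be
  won by counting.

  The obstacle is the cut with three edges. By parity every circuit meets it at most twice, so it
  passes the test meant to detect stars; the three edges joining the two triangles of a prism are an
  example. Such preimages are not excluded one by one. They are tolerated because three is also the
  minimum degree of \<open>G\<close>, so they cannot spoil the comparison of degree sums.

  Two disjoint paths are all that is ever asked of Menger's theorem: it is applied in
  \<open>G\<close>, in \<open>G\<close> minus a vertex, and inside one side of a cut, each of which
  survives the loss of any one vertex.\<close>

text \<open>\<open>gpath E a S F b\<close>: a path from \<open>a\<close> to \<open>b\<close> with vertex set \<open>S\<close> and edge set \<open>F\<close>.\<close>
inductive gpath :: "'a set set \<Rightarrow> 'a \<Rightarrow> 'a set \<Rightarrow> 'a set set \<Rightarrow> 'a \<Rightarrow> bool" for E where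
  gpath_refl: "gpath E a {a} {} a"
| gpath_step: "{a, c} \<in> E \<Longrightarrow> a \<notin> S \<Longrightarrow> gpath E c S F b \<Longrightarrow> gpath E a (insert a S) (insert {a, c} F) b"

lemma gpath_facts:
  assumes "gpath E a S F b"
  shows gpath_start: "a \<in> S" and gpath_end: "b \<in> S" and gpath_finite: "finite S"
    and gpath_finite_edges: "finite F" and gpath_subset: "F \<subseteq> E"
    and gpath_edge_subset: "\<And>e. e \<in> F \<Longrightarrow> e \<subseteq> S"
    and gpath_card_edge: "\<And>e. e \<in> F \<Longrightarrow> card e = 2"
    and gpath_verts: "S \<subseteq> insert a (\<Union>F)"
  using assms
proof (induction rule: gpath.induct)
  case (gpath_step a c S F b)
  { case 6 then show ?case using gpath_step by blast }
  { case (7 e)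
    have "a \<noteq> c" using gpath_step by auto
    then show ?case using 7 gpath_step by auto }
qed auto

lemma gpath_mono: "gpath E a S F b \<Longrightarrow> F \<subseteq> E' \<Longrightarrow> gpath E' a S F b"
  by (induction rule: gpath.induct) (auto intro: gpath.intros)

lemma gpath_supergraph: "gpath E a S F b \<Longrightarrow> E \<subseteq> E' \<Longrightarrow> gpath E' a S F b"
  by (rule gpath_mono[of E]) (auto dest: gpath_subset)

lemma gpath_single: "{a, b} \<in> E \<Longrightarrow> a \<noteq> b \<Longrightarrow> gpath E a {a, b} {{a, b}} b"
  using gpath_step[of a b E "{b}" "{}" b] by (auto intro: gpath_refl)

lemma gpath_append:
  "gpath E a S F b \<Longrightarrow> gpath E b T G c \<Longrightarrow> S \<inter> T = {b} \<Longrightarrow> gpath E a (S \<union> T) (F \<union> G) c"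
proof (induction rule: gpath.induct)
  case (gpath_refl a)
  then show ?case by (metis gpath_start insert_absorb insert_is_Un sup_bot_left)
next
  case (gpath_step a x S F b)
  have "b \<in> S" using gpath_step gpath_end by metis
  then have "S \<inter> T = {b}" "a \<notin> T" using gpath_step by auto
  then show ?case using gpath_step gpath.gpath_step[of a x E "S \<union> T" "F \<union> G" c] by auto
qed

lemma gpath_join_edge:
  assumes "gpath E a S F c" "gpath E d T G b" "{c, d} \<in> E" "S \<inter> T = {}"
  shows "gpath E a (S \<union> T) (insert {c, d} (F \<union> G)) b"
proof -
  have c: "c \<in> S" using assms(1) by (rule gpath_end)
  have 1: "gpath E c (insert c T) (insert {c, d} G) b"
    by (rule gpath_step) (use assms c in auto)
  have "S \<inter> insert c T = {c}" using assms(4) c by auto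
  from gpath_append[OF assms(1) 1 this] show ?thesis using c by (simp add: insert_absorb)
qed

lemma gpath_rev: "gpath E a S F b \<Longrightarrow> gpath E b S F a"
proof (induction rule: gpath.induct)
  case (gpath_step a c S F b)
  have "gpath E b (S \<union> {a}) (insert {c, a} (F \<union> {})) a"
    by (rule gpath_join_edge) (use gpath_step in \<open>auto simp: insert_commute intro: gpath.gpath_refl\<close>)
  then show ?case by (simp add: insert_commute)
qed (rule gpath_refl)

lemma gpath_closed: "gpath E a S F a \<Longrightarrow> S = {a} \<and> F = {}"
  by (erule gpath.cases) (auto dest: gpath_end)

lemma gpath_split:
  assumes "gpath E a S F b" "x \<in> S"
  obtains S1 F1 S2 F2 where "gpath E a S1 F1 x" "gpath E x S2 F2 b"
    "S = S1 \<union> S2" "S1 \<inter> S2 = {x}" "F = F1 \<union> F2"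
  using assms
proof (induction arbitrary: thesis rule: gpath.induct)
  case (gpath_refl a)
  show ?case by (rule gpath_refl(1)[of "{a}" "{}" "{a}" "{}"]) (use gpath_refl in \<open>auto intro: gpath.intros\<close>)
next
  case (gpath_step a c S F b)
  show ?case
  proof (cases "x = a")
    case True
    show ?thesis
      by (rule gpath_step.prems(1)[of "{a}" "{}" "insert a S" "insert {a,c} F"])
        (use gpath_step True in \<open>auto intro: gpath.intros\<close>)
  next
    case False
    then obtain S1 F1 S2 F2 where *: "gpath E c S1 F1 x" "gpath E x S2 F2 b"
      "S = S1 \<union> S2" "S1 \<inter> S2 = {x}" "F = F1 \<union> F2"
      using gpath_step by (metis insertE)
    show ?thesis
      by (rule gpath_step.prems(1)[of "insert a S1" "insert {a,c} F1" S2 F2])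
        (use gpath_step * False in \<open>auto intro: gpath.intros\<close>)
  qed
qed

lemma gpath_split_edge:
  assumes "gpath E a S F b" "e \<in> F"
  obtains c d S1 F1 S2 F2 where "e = {c, d}" "gpath E a S1 F1 c" "gpath E d S2 F2 b"
    "S = S1 \<union> S2" "S1 \<inter> S2 = {}" "F = insert e (F1 \<union> F2)"
  using assms
proof (induction arbitrary: thesis rule: gpath.induct)
  case (gpath_step a x S F b)
  show ?case
  proof (cases "e = {a, x}")
    case True
    show ?thesis
      by (rule gpath_step.prems(1)[of a x "{a}" "{}" S F])
        (use gpath_step True in \<open>auto intro: gpath.intros\<close>)
  next
    case False
    then obtain c d S1 F1 S2 F2 where *: "e = {c, d}" "gpath E x S1 F1 c" "gpath E d S2 F2 b"
      "S = S1 \<union> S2" "S1 \<inter> S2 = {}" "F = insert e (F1 \<union> F2)"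
      using gpath_step by (metis insertE)
    show ?thesis
      by (rule gpath_step.prems(1)[of c d "insert a S1" "insert {a,x} F1" S2 F2])
        (use gpath_step * in \<open>auto intro: gpath.intros\<close>)
  qed
qed auto

lemma gpath_end_edge:
  assumes "gpath E a S F b" "{a, b} \<in> F"
  shows "S = {a, b} \<and> F = {{a, b}}"
  using assms
proof (cases rule: gpath.cases)
  case (gpath_step c S' F')
  have "{a, b} \<notin> F'" using gpath_step gpath_edge_subset[OF gpath_step(5)] by blast
  then have "c = b" using assms gpath_step by (auto simp: doubleton_eq_iff)
  then have "S' = {b} \<and> F' = {}" using gpath_step gpath_closed by metis
  then show ?thesis using gpath_step \<open>c = b\<close> by auto
qed (use assms in auto)

lemma gpath_first_hit:
  assumes "gpath E a S F b" "b \<in> B"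
  obtains S1 F1 b1 where "gpath E a S1 F1 b1" "b1 \<in> B" "S1 \<inter> B = {b1}" "S1 \<subseteq> S" "F1 \<subseteq> F"
  using assms
proof (induction arbitrary: thesis rule: gpath.induct)
  case (gpath_refl a)
  show ?case by (rule gpath_refl(1)[of "{a}" "{}" a]) (use gpath_refl in \<open>auto intro: gpath.intros\<close>)
next
  case (gpath_step a c S F b)
  show ?case
  proof (cases "a \<in> B")
    case True
    show ?thesis
      by (rule gpath_step.prems(1)[of "{a}" "{}" a]) (use True in \<open>auto intro: gpath.intros\<close>)
  next
    case False
    obtain S1 F1 b1 where *: "gpath E c S1 F1 b1" "b1 \<in> B" "S1 \<inter> B = {b1}" "S1 \<subseteq> S" "F1 \<subseteq> F"
      using gpath_step by metis
    show ?thesis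
      by (rule gpath_step.prems(1)[of "insert a S1" "insert {a,c} F1" b1])
        (use gpath_step * False in \<open>auto intro: gpath.intros\<close>)
  qed
qed

text \<open>The first path is abandoned at its first vertex on the second one, so the result is
  again a path and no walks are needed.\<close>

lemma gpath_trans:
  assumes "gpath E a S F b" "gpath E b T G c"
  obtains S' F' where "gpath E a S' F' c" "S' \<subseteq> S \<union> T" "F' \<subseteq> F \<union> G"
proof -
  obtain S1 F1 x where 1: "gpath E a S1 F1 x" "x \<in> T" "S1 \<inter> T = {x}" "S1 \<subseteq> S" "F1 \<subseteq> F"
    using gpath_first_hit[OF assms(1) gpath_start[OF assms(2)]] by metis
  obtain T1 G1 T2 G2 where 2: "gpath E b T1 G1 x" "gpath E x T2 G2 c" "T = T1 \<union> T2" "T1 \<inter> T2 = {x}" "G = G1 \<union> G2"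
    using gpath_split[OF assms(2) 1(2)] by metis
  have "gpath E a (S1 \<union> T2) (F1 \<union> G2) c" by (rule gpath_append[OF 1(1) 2(2)]) (use 1 2 in auto)
  then show thesis by (rule that) (use 1 2 in auto)
qed

lemma gpath_of_rtrancl:
  assumes "(u, w) \<in> {(x, y). {x, y} \<in> E}\<^sup>*"
  shows "\<exists>S F. gpath E u S F w"
  using assms
proof (induction rule: converse_rtrancl_induct)
  case base
  show ?case using gpath_refl by metis
next
  case (step u v)
  then obtain S F where *: "gpath E v S F w" by auto
  show ?case
  proof (cases "u \<in> S")
    case True
    then show ?thesis using gpath_split[OF *] by metis
  next
    case False
    then show ?thesis using gpath_step[of u v E S F w] * step by auto
  qed
qed

text \<open>One half of the induction step of \<open>menger2\<close>; the other half is the same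
  statement with the two ends exchanged. No path from \<open>A\<close> reaches \<open>y\<close>
  without \<open>s\<close>, since it could be continued to \<open>b0\<close>. A path from
  \<open>A\<close> to \<open>B\<close> must meet \<open>{s, x}\<close>: otherwise it would not use
  the edge \<open>{x, y}\<close> and would miss the separator \<open>s\<close>. Its part up to the
  first such vertex cannot contain \<open>{x, y}\<close> either, because it would have reached
  \<open>y\<close> first.\<close>

lemma menger2_step:
  assumes sep: "\<And>a b S F. a \<in> A \<Longrightarrow> b \<in> B \<Longrightarrow> gpath E a S F b \<Longrightarrow> s \<in> S"
    and x: "a0 \<in> A" "gpath E a0 S0 F0 x" "s \<notin> S0"
    and y: "b0 \<in> B" "gpath E y T0 G0 b0" "s \<notin> T0"
    and con: "\<exists>a\<in>A. \<exists>b\<in>B. \<exists>S F. gpath (insert {x, y} E) a S F b \<and> z \<notin> S"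
  shows "\<exists>a\<in>A. \<exists>b\<in>{s, x}. \<exists>S F. gpath E a S F b \<and> z \<notin> S"
proof -
  obtain a b S F where p: "a \<in> A" "b \<in> B" "gpath (insert {x, y} E) a S F b" "z \<notin> S"
    using con by blast
  have ny: False if u: "a \<in> A" "gpath E a S F y" "s \<notin> S" for a S F
  proof -
    obtain S' F' where "gpath E a S' F' b0" "S' \<subseteq> S \<union> T0" using gpath_trans[OF u(2) y(2)] by metis
    then show False using sep[OF u(1) y(1)] u(3) y(3) by blast
  qed
  have sx: "s \<noteq> x" "x \<noteq> y" using x gpath_end ny by metis+
  have "S \<inter> {s, x} \<noteq> {}"
  proof
    assume *: "S \<inter> {s, x} = {}"
    then have "{x, y} \<notin> F" using gpath_edge_subset[OF p(3)] by blast
    then have "gpath E a S F b" using gpath_mono[OF p(3)] gpath_subset[OF p(3)] by blast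
    then show False using sep p * by blast
  qed
  then obtain t where t: "t \<in> S" "t \<in> {s, x}" by blast
  obtain S' F' where S': "gpath (insert {x, y} E) a S' F' t" "S' \<subseteq> S"
    using gpath_split[OF p(3) t(1)] by (metis Un_upper1)
  obtain S1 F1 q where q: "gpath (insert {x, y} E) a S1 F1 q" "q \<in> {s, x}" "S1 \<inter> {s, x} = {q}" "S1 \<subseteq> S"
    using gpath_first_hit[OF S'(1) t(2)] S'(2) by (metis order_trans)
  have "{x, y} \<notin> F1"
  proof
    assume xy: "{x, y} \<in> F1"
    then have "x \<in> S1" "y \<in> S1" using gpath_edge_subset[OF q(1)] by auto
    then have "q = x" using q by auto
    obtain S2 F2 S3 F3 where r: "gpath (insert {x, y} E) a S2 F2 y" "gpath (insert {x, y} E) y S3 F3 q"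
      "S1 = S2 \<union> S3" "S2 \<inter> S3 = {y}"
      using gpath_split[OF q(1) \<open>y \<in> S1\<close>] by metis
    have "x \<notin> S2" using r \<open>q = x\<close> sx gpath_end[OF r(2)] by auto
    then have "{x, y} \<notin> F2" using gpath_edge_subset[OF r(1)] by blast
    then have "gpath E a S2 F2 y" using gpath_mono[OF r(1)] gpath_subset[OF r(1)] by blast
    moreover have "s \<notin> S2" using r q \<open>q = x\<close> sx by auto
    ultimately show False using ny p by blast
  qed
  then have "gpath E a S1 F1 q" using gpath_mono[OF q(1)] gpath_subset[OF q(1)] by blast
  then show ?thesis using p q by blast
qed

definition two_paths :: "'a set set \<Rightarrow> 'a set \<Rightarrow> 'a set \<Rightarrow> bool" where
  "two_paths E A B \<longleftrightarrow> (\<exists>a1 a2 b1 b2 S1 S2 F1 F2. {a1, a2} \<subseteq> A \<and> {b1, b2} \<subseteq> B \<and>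
     gpath E a1 S1 F1 b1 \<and> gpath E a2 S2 F2 b2 \<and> S1 \<inter> S2 = {})"

lemma two_pathsI:
  assumes "a1 \<in> A" "a2 \<in> A" "b1 \<in> B" "b2 \<in> B" "gpath E a1 S1 F1 b1" "gpath E a2 S2 F2 b2" "S1 \<inter> S2 = {}"
  shows "two_paths E A B"
  unfolding two_paths_def
  by (rule exI[of _ a1], rule exI[of _ a2], rule exI[of _ b1], rule exI[of _ b2], rule exI[of _ S1],
      rule exI[of _ S2], rule exI[of _ F1], rule exI[of _ F2]) (use assms in auto)

lemma two_paths_mono: "two_paths E A B \<Longrightarrow> E \<subseteq> E' \<Longrightarrow> two_paths E' A B"
  unfolding two_paths_def by (meson gpath_mono gpath_subset order_trans)

lemma two_paths_pair:
  assumes "two_paths E A {s, x}"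
  obtains a1 a2 S1 S2 F1 F2 where "a1 \<in> A" "a2 \<in> A" "gpath E a1 S1 F1 s" "gpath E a2 S2 F2 x" "S1 \<inter> S2 = {}"
proof -
  obtain a1 a2 b1 b2 S1 S2 F1 F2 where *: "{a1, a2} \<subseteq> A" "{b1, b2} \<subseteq> {s, x}"
     "gpath E a1 S1 F1 b1" "gpath E a2 S2 F2 b2" "S1 \<inter> S2 = {}"
    using assms unfolding two_paths_def by metis
  have "b1 \<in> S1" "b2 \<in> S2" using * by (auto intro: gpath_end)
  then have "b1 \<noteq> b2" using * by auto
  then consider "b1 = s" "b2 = x" | "b1 = x" "b2 = s" using * by auto
  then show thesis
  proof cases
    case 1 then show ?thesis using that[of a1 a2 S1 F1 S2 F2] * by auto
  next
    case 2 then show ?thesis using that[of a2 a1 S2 F2 S1 F1] * by auto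
  qed
qed

text \<open>Goering's induction on the number of edges: if deleting \<open>x y\<close> creates a separating vertex \<open>s\<close>, then
  two paths from \<open>A\<close> to \<open>{s, x}\<close> and two paths from \<open>{s, y}\<close> to \<open>B\<close> can be joined.\<close>
theorem menger2:
  assumes "finite E" "\<And>e. e \<in> E \<Longrightarrow> \<exists>x y. e = {x, y}"
    and "\<And>z. \<exists>a\<in>A. \<exists>b\<in>B. \<exists>S F. gpath E a S F b \<and> z \<notin> S"
  shows "two_paths E A B"
  using assms
proof (induction arbitrary: A B rule: finite_induct)
  case empty
  \<comment> \<open>Without edges every path is a single vertex, so \<open>A\<close> and
    \<open>B\<close> have to share two vertices.\<close>
  have *: "\<exists>a\<in>A \<inter> B. a \<noteq> z" for z
  proof -
    obtain a b S F where 1: "a \<in> A" "b \<in> B" "gpath {} a S F b" "z \<notin> S"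
      using empty.prems(2)[of z] by blast
    then have "a = b \<and> S = {a}" by (auto elim: gpath.cases)
    then show ?thesis using 1 by auto
  qed
  obtain a1 where a1: "a1 \<in> A \<inter> B" using *[of undefined] by blast
  obtain a2 where a2: "a2 \<in> A \<inter> B" "a2 \<noteq> a1" using *[of a1] by blast
  have "gpath {} a1 {a1} {} a1" "gpath {} a2 {a2} {} a2" by (rule gpath_refl)+
  then show ?case unfolding two_paths_def using a1 a2
    by (intro exI[of _ a1] exI[of _ a2] exI[of _ "{a1}"] exI[of _ "{a2}"] exI[of _ "{}"]) auto
next
  case (insert e E)
  show ?case
  proof (cases "\<forall>z. \<exists>a\<in>A. \<exists>b\<in>B. \<exists>S F. gpath E a S F b \<and> z \<notin> S")
    case True
    then have "two_paths E A B" using insert by blast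
    then show ?thesis by (rule two_paths_mono) auto
  next
    case False
    then obtain s where s: "\<And>a b S F. a \<in> A \<Longrightarrow> b \<in> B \<Longrightarrow> gpath E a S F b \<Longrightarrow> s \<in> S" by blast
    obtain a0 b0 S F where p: "a0 \<in> A" "b0 \<in> B" "gpath (insert e E) a0 S F b0" "s \<notin> S"
      using insert.prems(2) by blast
    have "e \<in> F" using s[of a0 b0 S F] p gpath_mono[OF p(3)] gpath_subset[OF p(3)] by blast
    then obtain x y S1 F1 S2 F2 where q: "e = {x, y}" "gpath (insert e E) a0 S1 F1 x" "gpath (insert e E) y S2 F2 b0"
      "S = S1 \<union> S2" "S1 \<inter> S2 = {}" "F = insert e (F1 \<union> F2)"
      using gpath_split_edge[OF p(3)] by metis
    have "x \<in> S1" "y \<in> S2" using gpath_end[OF q(2)] gpath_start[OF q(3)] by auto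
    then have "y \<notin> S1" "x \<notin> S2" using q by auto
    then have "e \<notin> F1" "e \<notin> F2" using q gpath_edge_subset[OF q(2)] gpath_edge_subset[OF q(3)] by auto
    then have x: "gpath E a0 S1 F1 x" and y: "gpath E y S2 F2 b0"
      using gpath_mono[OF q(2)] gpath_mono[OF q(3)] gpath_subset[OF q(2)] gpath_subset[OF q(3)] by blast+
    have s': "s \<notin> S1" "s \<notin> S2" using p q by auto
    have "two_paths E A {s, x}"
    proof (rule insert.IH)
      show "\<exists>a\<in>A. \<exists>b\<in>{s, x}. \<exists>S F. gpath E a S F b \<and> z \<notin> S" for z
        by (rule menger2_step[OF s p(1) x s'(1) p(2) y s'(2)])
          (use insert.prems(2) q in auto)
    qed (use insert.prems in auto)
    then obtain a1 a2 P1 P2 G1 G2 where A: "a1 \<in> A" "a2 \<in> A" "gpath E a1 P1 G1 s" "gpath E a2 P2 G2 x" "P1 \<inter> P2 = {}"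
      using two_paths_pair by metis
    have "two_paths E B {s, y}"
    proof (rule insert.IH)
      show "\<exists>a\<in>B. \<exists>b\<in>{s, y}. \<exists>S F. gpath E a S F b \<and> z \<notin> S" for z
      proof (rule menger2_step[OF _ p(2) gpath_rev[OF y] s'(2) p(1) gpath_rev[OF x] s'(1)])
        show "s \<in> S" if "a \<in> B" "b \<in> A" "gpath E a S F b" for a b S F
          using s that gpath_rev by metis
        show "\<exists>a\<in>B. \<exists>b\<in>A. \<exists>S F. gpath (insert {y, x} E) a S F b \<and> z \<notin> S"
          using insert.prems(2)[of z] q gpath_rev by (metis insert_commute)
      qed
    qed (use insert.prems in auto)
    then obtain b1 b2 Q1 Q2 H1 H2 where B: "b1 \<in> B" "b2 \<in> B" "gpath E b1 Q1 H1 s" "gpath E b2 Q2 H2 y" "Q1 \<inter> Q2 = {}"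
      using two_paths_pair by metis
    have sub: "\<exists>S F. gpath E a S F u \<and> s \<notin> S" if g: "gpath E a P G t" "u \<in> P" "u \<noteq> s" "s \<in> P \<longrightarrow> t = s" for a P G t u
    proof -
      obtain P' G' P'' G'' where "gpath E a P' G' u" "gpath E u P'' G'' t" "P = P' \<union> P''" "P' \<inter> P'' = {u}"
        using gpath_split[OF g(1,2)] by metis
      moreover from this have "t \<in> P''" "u \<in> P''" by (auto intro: gpath_end gpath_start)
      ultimately have "s \<notin> P'" using g by auto
      then show ?thesis using \<open>gpath E a P' G' u\<close> by blast
    qed
    \<comment> \<open>A common vertex other than \<open>s\<close> would link \<open>A\<close> to
      \<open>B\<close> around the separator \<open>s\<close>.\<close>
    have meet: "P \<inter> Q \<subseteq> {s}" if u: "a \<in> A" "b \<in> B" "gpath E a P G t" "gpath E b Q H t'"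
      "s \<in> P \<longrightarrow> t = s" "s \<in> Q \<longrightarrow> t' = s" for P Q G H a b t t'
    proof (rule ccontr)
      assume "\<not> P \<inter> Q \<subseteq> {s}"
      then obtain v where v: "v \<in> P" "v \<in> Q" "v \<noteq> s" by blast
      obtain S F where 1: "gpath E a S F v" "s \<notin> S" using sub[OF u(3) v(1,3) u(5)] by blast
      obtain T G where 2: "gpath E b T G v" "s \<notin> T" using sub[OF u(4) v(2,3) u(6)] by blast
      obtain S' F' where 3: "gpath E a S' F' b" "S' \<subseteq> S \<union> T" using gpath_trans[OF 1(1) gpath_rev[OF 2(1)]] by metis
      show False using s[OF u(1,2) 3(1)] 3(2) 1(2) 2(2) by blast
    qed
    have sm: "s \<in> P1" "s \<in> Q1" using gpath_end[OF A(3)] gpath_end[OF B(3)] by auto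
    then have sn: "s \<notin> P2" "s \<notin> Q2" using A(5) B(5) by auto
    have "P1 \<inter> Q1 \<subseteq> {s}" by (rule meet[OF A(1) B(1) A(3) B(3)]) simp_all
    then have i1: "P1 \<inter> Q1 = {s}" using sm by blast
    have "P1 \<inter> Q2 \<subseteq> {s}" by (rule meet[OF A(1) B(2) A(3) B(4)]) (simp_all add: sn)
    then have i2: "P1 \<inter> Q2 = {}" using sn by blast
    have "P2 \<inter> Q1 \<subseteq> {s}" by (rule meet[OF A(2) B(1) A(4) B(3)]) (simp_all add: sn)
    then have i3: "P2 \<inter> Q1 = {}" using sn by blast
    have "P2 \<inter> Q2 \<subseteq> {s}" by (rule meet[OF A(2) B(2) A(4) B(4)]) (simp_all add: sn)
    then have i4: "P2 \<inter> Q2 = {}" using sn by blast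
    have m: "gpath E a S F b \<Longrightarrow> gpath (insert e E) a S F b" for a b S F
      by (erule gpath_supergraph) blast
    have c1: "gpath (insert e E) a1 (P1 \<union> Q1) (G1 \<union> H1) b1"
      by (rule m[OF gpath_append[OF A(3) gpath_rev[OF B(3)] i1]])
    have c2: "gpath (insert e E) a2 (P2 \<union> Q2) (insert {x, y} (G2 \<union> H2)) b2"
      by (rule gpath_join_edge[OF m[OF A(4)] m[OF gpath_rev[OF B(4)]] _ i4]) (use q in auto)
    have "(P1 \<union> Q1) \<inter> (P2 \<union> Q2) = {}" using i2 i3 A(5) B(5) by blast
    then show ?thesis by (rule two_pathsI[OF A(1,2) B(1,2) c1 c2])
  qed
qed

section \<open>Circuits and cuts\<close>
text \<open>A path closed by an edge, which suits induction better than the index arithmetic of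
  \<open>cycle_edges\<close>. Requiring three vertices rules out a path that consists of the closing
  edge itself.\<close>

definition circ :: "'a set set \<Rightarrow> 'a set set \<Rightarrow> bool" where
  "circ E C \<longleftrightarrow> (\<exists>a b S F. gpath E a S F b \<and> {a, b} \<in> E \<and> 3 \<le> card S \<and> C = insert {a, b} F)"

text \<open>The closing edge is not special: the path is split at \<open>e\<close>, and the two
  pieces are rejoined through the old closing edge.\<close>

lemma circ_edge_ex:
  assumes "circ E C" "e \<in> C"
  shows "\<exists>c d S. e = {c, d} \<and> c \<noteq> d \<and> gpath E c S (C - {e}) d \<and> 3 \<le> card S"
proof -
  obtain a b S F where C: "gpath E a S F b" "{a, b} \<in> E" "3 \<le> card S" "C = insert {a, b} F"
    using assms unfolding circ_def by metis
  have ab: "a \<noteq> b" using C(1,3) gpath_closed by fastforce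
  have "card {a, b} \<le> 2" by (simp add: card_insert_if)
  then have n: "{a, b} \<notin> F" using C gpath_end_edge[OF C(1)] by auto
  show ?thesis
  proof (cases "e = {a, b}")
    case True
    then have "C - {e} = F" using C n by auto
    then show ?thesis using True C ab by blast
  next
    case False
    then have "e \<in> F" using assms C by auto
    then obtain c d S1 F1 S2 F2 where s: "e = {c, d}" "gpath E a S1 F1 c" "gpath E d S2 F2 b"
      "S = S1 \<union> S2" "S1 \<inter> S2 = {}" "F = insert e (F1 \<union> F2)"
      using gpath_split_edge[OF C(1)] by metis
    have "gpath E d (S2 \<union> S1) (insert {b, a} (F2 \<union> F1)) c"
      by (rule gpath_join_edge[OF s(3,2)]) (use C s in \<open>auto simp: insert_commute\<close>)
    moreover have "c \<in> S1" "d \<in> S2" using gpath_end[OF s(2)] gpath_start[OF s(3)] by auto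
    moreover from this have ne: "e \<notin> F1" "e \<notin> F2" "c \<noteq> d"
      using s(1,5) gpath_edge_subset[OF s(2)] gpath_edge_subset[OF s(3)] by blast+
    moreover from ne have "C - {e} = insert {b, a} (F2 \<union> F1)" using C s False by (auto simp: insert_commute)
    ultimately show ?thesis using s C(3) by (metis insert_commute Un_commute)
  qed
qed

lemma circ_edge:
  assumes "circ E C" "{c, d} \<in> C"
  shows "\<exists>S. gpath E c S (C - {{c, d}}) d \<and> 3 \<le> card S"
proof -
  obtain c' d' S where *: "{c, d} = {c', d'}" "gpath E c' S (C - {{c, d}}) d'" "3 \<le> card S"
    using circ_edge_ex[OF assms] by metis
  then consider "c = c'" "d = d'" | "c = d'" "d = c'" by (auto simp: doubleton_eq_iff)
  then show ?thesis
  proof cases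
    case 1 then show ?thesis using *(2,3) by auto
  next
    case 2 then show ?thesis using gpath_rev[OF *(2)] *(3) by auto
  qed
qed

lemma circ_subset: "circ E C \<Longrightarrow> C \<subseteq> E"
  unfolding circ_def by (auto dest: gpath_subset)

lemma circ_finite: "circ E C \<Longrightarrow> finite C"
  unfolding circ_def by (auto dest: gpath_finite_edges)

lemma circ_nonempty: "circ E C \<Longrightarrow> C \<noteq> {}"
  unfolding circ_def by auto

lemma circ_card: "circ E C \<Longrightarrow> 3 \<le> card C"
proof -
  have *: "card S = Suc (card F)" if "gpath E a S F b" for a S F b
    using that
  proof (induction rule: gpath.induct)
    case (gpath_step a c S F b)
    have "{a, c} \<notin> F" using gpath_edge_subset[OF gpath_step(3)] gpath_step(2) by auto
    then show ?case using gpath_step gpath_finite[OF gpath_step(3)] gpath_finite_edges[OF gpath_step(3)] by simp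
  qed simp
  assume C: "circ E C"
  obtain e where "e \<in> C" using circ_nonempty[OF C] by auto
  then obtain c d S where "gpath E c S (C - {e}) d" "3 \<le> card S" using circ_edge_ex[OF C] by metis
  then show ?thesis using * \<open>e \<in> C\<close> circ_finite[OF C] by (metis card.remove)
qed

lemma circ_supergraph: "circ E C \<Longrightarrow> E \<subseteq> E' \<Longrightarrow> circ E' C"
  unfolding circ_def by (elim exE conjE, drule gpath_supergraph) blast+

lemma gpath_start_degree:
  assumes "gpath E a S F b" "a \<noteq> b"
  shows "\<exists>g. {h \<in> F. a \<in> h} = {g}"
  using assms
proof (cases rule: gpath.cases)
  case (gpath_step c S' F')
  have "{h \<in> F. a \<in> h} = {{a, c}}" using gpath_step gpath_edge_subset[OF gpath_step(5)] by auto
  then show ?thesis by blast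
qed auto

lemma circ_degree:
  assumes "circ E C" "w \<in> \<Union>C"
  shows "card {e \<in> C. w \<in> e} = 2"
proof -
  obtain e where e: "e \<in> C" "w \<in> e" using assms by auto
  then obtain d where d: "e = {w, d}" "w \<noteq> d" using circ_edge_ex[OF assms(1) e(1)] by auto
  obtain S where S: "gpath E w S (C - {e}) d" using circ_edge[OF assms(1)] e d by blast
  obtain g where g: "{h \<in> C - {e}. w \<in> h} = {g}" using gpath_start_degree[OF S d(2)] by blast
  then have "{h \<in> C. w \<in> h} = {e, g}" "e \<noteq> g" using e by auto
  then show ?thesis by simp
qed

lemma circ_degree_even: "circ E C \<Longrightarrow> even (card {e \<in> C. w \<in> e})"
proof (cases "w \<in> \<Union>C")
  case False
  then have "{e \<in> C. w \<in> e} = {}" by auto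
  then show ?thesis by (metis card.empty even_zero)
qed (simp add: circ_degree)

lemma circ_degree_le: "circ E C \<Longrightarrow> card {e \<in> C. w \<in> e} \<le> 2"
proof (cases "w \<in> \<Union>C")
  case False
  then have "{e \<in> C. w \<in> e} = {}" by auto
  then show ?thesis by (metis card.empty zero_le)
qed (simp add: circ_degree)

text \<open>Only one edge of the path is incident with its start, so an even subset cannot contain
  that edge; peeling it off leaves a shorter path.\<close>

lemma gpath_no_even_subset:
  assumes "gpath E a S F b" "D \<subseteq> F" "\<And>w. w \<noteq> b \<Longrightarrow> even (card {e \<in> D. w \<in> e})"
  shows "D = {}"
  using assms
proof (induction arbitrary: D rule: gpath.induct)
  case (gpath_step a c S F b)
  have "b \<in> S" by (rule gpath_end[OF gpath_step(3)])
  then have ab: "a \<noteq> b" using gpath_step by auto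
  have *: "{e \<in> D. a \<in> e} \<subseteq> {{a, c}}"
    using gpath_step.prems(1) gpath_step(2) gpath_edge_subset[OF gpath_step(3)] by auto
  have "{a, c} \<notin> D"
  proof
    assume "{a, c} \<in> D"
    then have "{e \<in> D. a \<in> e} = {{a, c}}" using * by auto
    then have "card {e \<in> D. a \<in> e} = 1" by simp
    then show False using gpath_step.prems(2)[OF ab] by simp
  qed
  then have "D \<subseteq> F" using gpath_step.prems(1) by auto
  then show ?case using gpath_step by blast
qed auto

text \<open>An omitted edge opens the circuit to a path, and a path has no nonempty even
  subset.\<close>

lemma circ_minimal:
  assumes "circ E C" "D \<subseteq> C" "D \<noteq> {}" "\<And>w. even (card {e \<in> D. w \<in> e})"
  shows "D = C"
proof (rule ccontr)
  assume "D \<noteq> C"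
  then obtain e where e: "e \<in> C" "e \<notin> D" using assms by auto
  obtain c d S where "gpath E c S (C - {e}) d" using circ_edge_ex[OF assms(1) e(1)] by metis
  from gpath_no_even_subset[OF this, of D] show False using assms e by auto
qed

lemma circ_not_subset: "circ E C \<Longrightarrow> circ E D \<Longrightarrow> D \<subseteq> C \<Longrightarrow> D = C"
  using circ_minimal circ_nonempty circ_degree_even by metis

text \<open>Disjointness of the edge sets does not follow from the condition on the vertices: both
  paths could be the single edge \<open>{a, b}\<close>. It also supplies the third vertex when one
  of the paths is that edge.\<close>

lemma circ_two_paths:
  assumes "gpath E a S F b" "gpath E a T G b" "S \<inter> T = {a, b}" "a \<noteq> b" "F \<inter> G = {}"
  shows "circ E (F \<union> G)"
  using assms(1)
proof (cases rule: gpath.cases)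
  case (gpath_step c S' F')
  have a: "a \<in> T" and b: "b \<in> T" using gpath_start gpath_end assms(2) by metis+
  have bS': "b \<in> S'" "c \<in> S'" using gpath_start gpath_end gpath_step(5) by metis+
  have i: "S' \<inter> T = {b}" using assms(3) gpath_step bS' b by auto
  have p: "gpath E c (S' \<union> T) (F' \<union> G) a"
    by (rule gpath_append[OF gpath_step(5) gpath_rev[OF assms(2)] i])
  have fin: "finite (S' \<union> T)" using gpath_finite[OF gpath_step(5)] gpath_finite[OF assms(2)] by simp
  have "3 \<le> card (S' \<union> T)"
  proof (cases "c = b")
    case False
    have "{a, b, c} \<subseteq> S' \<union> T" using a b bS' by auto
    moreover have "a \<noteq> c" using gpath_step(4) bS' by auto
    then have "card {a, b, c} = 3" using False assms(4) by auto
    ultimately show ?thesis using card_mono[OF fin] by metis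
  next
    case True
    have "T \<noteq> {a, b}"
    proof
      assume T: "T = {a, b}"
      have "G \<noteq> {}" using gpath_verts[OF assms(2)] b assms(4) by auto
      then obtain g where g: "g \<in> G" by auto
      have "card g = 2" "g \<subseteq> {a, b}" using gpath_card_edge[OF assms(2) g] gpath_edge_subset[OF assms(2) g] T by auto
      then have "g = {a, b}" using assms(4) by (metis card_2_iff card_subset_eq finite.emptyI finite.insertI)
      then show False using g True gpath_step assms(5) by auto
    qed
    then obtain x where x: "x \<in> T" "x \<noteq> a" "x \<noteq> b" using a b by auto
    have "{a, b, x} \<subseteq> S' \<union> T" using a b x by auto
    moreover have "card {a, b, x} = 3" using x assms(4) by auto
    ultimately show ?thesis using card_mono[OF fin] by metis
  qed
  moreover have "F \<union> G = insert {c, a} (F' \<union> G)" using gpath_step by (auto simp: insert_commute)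
  moreover have "{c, a} \<in> E" using gpath_step by (simp add: insert_commute)
  ultimately show ?thesis unfolding circ_def using p by blast
qed (use assms in auto)

lemma circ_arcs:
  assumes "circ E C" "u \<in> \<Union>C" "v \<in> \<Union>C" "u \<noteq> v"
  obtains S F T G where "gpath E u S F v" "gpath E u T G v" "S \<inter> T = {u, v}" "F \<inter> G = {}"
    "C = F \<union> G" "\<Union>C = S \<union> T"
proof -
  obtain e where e: "e \<in> C" "u \<in> e" using assms by auto
  then obtain d where d: "e = {u, d}" "u \<noteq> d" using circ_edge_ex[OF assms(1) e(1)] by auto
  obtain S where S: "gpath E u S (C - {e}) d" using circ_edge[OF assms(1)] e d by blast
  have un: "\<Union>C = S"
  proof -
    have "u \<in> S" "d \<in> S" using gpath_start gpath_end S by metis+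
    then show ?thesis using gpath_verts[OF S] gpath_edge_subset[OF S] e d by blast
  qed
  then obtain S1 F1 S2 F2 where s: "gpath E u S1 F1 v" "gpath E v S2 F2 d"
    "S = S1 \<union> S2" "S1 \<inter> S2 = {v}" "C - {e} = F1 \<union> F2"
    using gpath_split[OF S] assms by metis
  have eE: "e \<in> E" using e circ_subset[OF assms(1)] by auto
  have m: "u \<in> S1" "v \<in> S1" "v \<in> S2" "d \<in> S2" using gpath_start gpath_end s by metis+
  have un2: "u \<notin> S2" using m s assms by auto
  have 1: "gpath E u (insert u S2) (insert {u, d} F2) v"
    by (rule gpath_step) (use eE d un2 gpath_rev[OF s(2)] in auto)
  have "F1 \<inter> F2 = {}"
  proof (rule ccontr)
    assume "F1 \<inter> F2 \<noteq> {}"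
    then obtain g where g: "g \<in> F1" "g \<in> F2" by auto
    then have "g \<subseteq> {v}" using gpath_edge_subset[OF s(1)] gpath_edge_subset[OF s(2)] s by blast
    then have "card g \<le> 1" using card_mono[of "{v}" g] by simp
    then show False using gpath_card_edge[OF s(1) g(1)] by simp
  qed
  then show thesis
    by (intro that[OF s(1) 1]) (use s m un e d in auto)
qed

section \<open>Cuts and their parity along paths and circuits\<close>

definition cut :: "'a set set \<Rightarrow> 'a set \<Rightarrow> 'a set set" where
  "cut E X = {e \<in> E. e \<inter> X \<noteq> {} \<and> e - X \<noteq> {}}"

lemma cut_pair [simp]: "{x, y} \<in> cut E X \<longleftrightarrow> {x, y} \<in> E \<and> (x \<in> X) \<noteq> (y \<in> X)"
  by (auto simp: cut_def)

lemma cut_subset: "cut E X \<subseteq> E"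
  by (auto simp: cut_def)

lemma cut_eq_star:
  assumes "\<And>e. e \<in> E \<Longrightarrow> \<exists>x y. e = {x, y} \<and> x \<noteq> y"
  shows "cut E {v} = {e \<in> E. v \<in> e}"
  using assms unfolding cut_def by blast

lemma cut_complement:
  assumes "\<And>e. e \<in> E \<Longrightarrow> e \<subseteq> V"
  shows "cut E (V - X) = cut E X"
  using assms unfolding cut_def by blast

text \<open>Each cut edge on the path changes sides. The path may live in a subgraph while the cut
  is taken in the larger graph.\<close>

lemma gpath_cut_parity:
  assumes "gpath E a S F b" "E \<subseteq> E'"
  shows "odd (card (F \<inter> cut E' X)) \<longleftrightarrow> (a \<in> X) \<noteq> (b \<in> X)"
  using assms
proof (induction rule: gpath.induct)
  case (gpath_step a c S F b)
  have n: "{a, c} \<notin> F" using gpath_edge_subset[OF gpath_step(3)] gpath_step(2) by auto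
  have f: "finite F" using gpath_finite_edges[OF gpath_step(3)] .
  have e: "{a, c} \<in> E'" using gpath_step by auto
  show ?case
  proof (cases "(a \<in> X) = (c \<in> X)")
    case True
    then have "insert {a, c} F \<inter> cut E' X = F \<inter> cut E' X" by auto
    then show ?thesis using True gpath_step by auto
  next
    case False
    then have "insert {a, c} F \<inter> cut E' X = insert {a, c} (F \<inter> cut E' X)" using e by auto
    then show ?thesis using False gpath_step n f by auto
  qed
qed auto

lemma circ_cut_even:
  assumes "circ E C"
  shows "even (card (C \<inter> cut E X))"
proof -
  obtain e where "e \<in> C" using circ_nonempty[OF assms] by auto
  then obtain c d S where *: "e = {c, d}" "gpath E c S (C - {e}) d" using circ_edge_ex[OF assms] by metis
  have e: "e \<in> E" using \<open>e \<in> C\<close> circ_subset[OF assms] by auto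
  have p: "odd (card ((C - {e}) \<inter> cut E X)) \<longleftrightarrow> (c \<in> X) \<noteq> (d \<in> X)" by (rule gpath_cut_parity[OF *(2)]) simp
  have f: "finite (C - {e})" using circ_finite[OF assms] by simp
  show ?thesis
  proof (cases "(c \<in> X) = (d \<in> X)")
    case True
    then have "C \<inter> cut E X = (C - {e}) \<inter> cut E X" using * by auto
    then show ?thesis using True p by auto
  next
    case False
    then have "C \<inter> cut E X = insert e ((C - {e}) \<inter> cut E X)" using * e \<open>e \<in> C\<close> by auto
    then show ?thesis using False p f by auto
  qed
qed

lemma gpath_within:
  assumes "gpath E a S F b" "F \<inter> cut E X = {}" "a \<in> X"
  shows "S \<subseteq> X"
  using assms by (induction rule: gpath.induct) auto

lemma circ_within:
  assumes "circ E C" "C \<inter> cut E X = {}" "u \<in> \<Union>C" "v \<in> \<Union>C" "u \<in> X"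
  shows "v \<in> X"
proof (cases "u = v")
  case False
  obtain S F where S: "gpath E u S F v" "F \<subseteq> C"
    using circ_arcs[OF assms(1,3,4) False] by (metis Un_upper1)
  have "F \<inter> cut E X = {}" using S(2) assms(2) by blast
  then have "S \<subseteq> X" by (rule gpath_within[OF S(1) _ assms(5)])
  then show ?thesis using gpath_end[OF S(1)] by blast
qed (use assms in simp)

text \<open>A set of edges meeting every circuit evenly is a cut: adding one edge to the graph either
  closes a circuit, which forces the parity, or joins two components, one of which can be flipped.\<close>
theorem even_imp_cut:
  assumes "finite E" "\<And>e. e \<in> E \<Longrightarrow> \<exists>x y. e = {x, y} \<and> x \<noteq> y"
    and "\<And>C. circ E C \<Longrightarrow> even (card (C \<inter> D))" and "D \<subseteq> E"
  shows "\<exists>X. D = cut E X"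
  using assms
proof (induction arbitrary: D rule: finite_induct)
  case empty
  then show ?case by (auto simp: cut_def)
next
  case (insert e E)
  obtain x y where xy: "e = {x, y}" "x \<noteq> y" using insert.prems(1) by blast
  have sub: "E \<subseteq> insert e E" by auto
  have "\<exists>X. D \<inter> E = cut E X"
  proof (rule insert.IH)
    fix C assume C: "circ E C"
    have "C \<inter> (D \<inter> E) = C \<inter> D" using circ_subset[OF C] by auto
    then show "even (card (C \<inter> (D \<inter> E)))" using insert.prems(2) circ_supergraph[OF C sub] by simp
  qed (use insert.prems in auto)
  then obtain X where X: "D \<inter> E = cut E X" by blast
  show ?case
  proof (cases "\<exists>S F. gpath E x S F y")
    case True
    then obtain S F where p: "gpath E x S F y" by blast
    have eF: "e \<notin> F" using gpath_subset[OF p] insert.hyps by auto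
    have fin: "finite F" using gpath_finite_edges[OF p] .
    have "3 \<le> card S"
    proof (rule ccontr)
      assume "\<not> 3 \<le> card S"
      then have "card S \<le> card {x, y}" using xy by simp
      moreover have "{x, y} \<subseteq> S" using gpath_start[OF p] gpath_end[OF p] by auto
      ultimately have S: "S = {x, y}" using card_seteq[OF gpath_finite[OF p]] by metis
      have "F \<noteq> {}" using gpath_verts[OF p] S xy by auto
      then obtain g where g: "g \<in> F" by auto
      then have "g \<subseteq> {x, y}" "card g = 2" using gpath_edge_subset[OF p g] gpath_card_edge[OF p g] S by auto
      then have "g = e" using xy by (metis card_2_iff card_subset_eq finite.emptyI finite.insertI)
      then show False using g eF by auto
    qed
    then have "circ (insert e E) (insert e F)"
      unfolding circ_def using gpath_supergraph[OF p sub] xy by blast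
    then have ev: "even (card (insert e F \<inter> D))" by (rule insert.prems(2))
    have "F \<inter> D = F \<inter> cut E X" using gpath_subset[OF p] X by auto
    moreover have "odd (card (F \<inter> cut E X)) \<longleftrightarrow> (x \<in> X) \<noteq> (y \<in> X)" by (rule gpath_cut_parity[OF p]) simp
    ultimately have "e \<in> D \<longleftrightarrow> (x \<in> X) \<noteq> (y \<in> X)" using ev eF fin
      by (cases "e \<in> D") (auto simp: Int_insert_left)
    then have "D = cut (insert e E) X" using X insert.prems(3) xy by (auto simp: cut_def)
    then show ?thesis by blast
  next
    case False
    define K where "K = {v. \<exists>S F. gpath E x S F v}"
    have "x \<in> K" unfolding K_def using gpath_refl[of E x] by auto
    have "y \<notin> K" unfolding K_def using False by blast
    have K: "u \<in> K \<longleftrightarrow> v \<in> K" if uv: "{u, v} \<in> E" for u v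
    proof -
      have *: "v' \<in> K" if u: "u' \<in> K" "{u', v'} \<in> E" for u' v'
      proof -
        obtain S F where S: "gpath E x S F u'" using u unfolding K_def by blast
        have "(u', v') \<in> {(x, y). {x, y} \<in> E}\<^sup>*" using u by auto
        then obtain T G where "gpath E u' T G v'" using gpath_of_rtrancl by metis
        then obtain S' F' where "gpath E x S' F' v'" using gpath_trans[OF S] by metis
        then show ?thesis unfolding K_def by auto
      qed
      show ?thesis using *[of u v] *[of v u] uv by (auto simp: insert_commute)
    qed
    \<comment> \<open>The second alternative is the symmetric difference of \<open>X\<close> and the
      component \<open>K\<close> of \<open>x\<close>. No edge of \<open>E\<close> leaves
      \<open>K\<close>, so the old cut is unchanged, while \<open>e\<close> changes its status
      because only one of its ends lies in \<open>K\<close>.\<close>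
    define Y where "Y = (if (e \<in> D) = ((x \<in> X) \<noteq> (y \<in> X)) then X else {v. (v \<in> X) \<noteq> (v \<in> K)})"
    have "e \<in> D \<longleftrightarrow> (x \<in> Y) \<noteq> (y \<in> Y)" using \<open>x \<in> K\<close> \<open>y \<notin> K\<close> unfolding Y_def by auto
    moreover have cut_eq: "g \<in> cut E X \<longleftrightarrow> g \<in> cut E Y" if g: "g \<in> E" for g
    proof -
      obtain u v where uv: "g = {u, v}" using g insert.prems(1) by blast
      then have "(u \<in> X) = (v \<in> X) \<longleftrightarrow> (u \<in> Y) = (v \<in> Y)" using K[of u v] g unfolding Y_def by auto
      then show ?thesis using uv by simp
    qed
    ultimately have "g \<in> D \<longleftrightarrow> g \<in> cut (insert e E) Y" if g: "g \<in> insert e E" for g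
    proof (cases "g = e")
      case False
      then have "g \<in> D \<longleftrightarrow> g \<in> cut E X" using X g by auto
      also have "\<dots> \<longleftrightarrow> g \<in> cut (insert e E) Y" using cut_eq[of g] g False by (auto simp: cut_def)
      finally show ?thesis .
    qed (use xy in simp)
    then have "D = cut (insert e E) Y" using insert.prems(3) cut_subset[of "insert e E" Y] by auto
    then show ?thesis by blast
  qed
qed

text \<open>In a forest every edge set is a cut, so \<open>2 ^ card E \<le> 2 ^ (card V - 1)\<close>.\<close>
lemma forest_card:
  assumes "finite V" "r \<in> V" "\<And>e. e \<in> E \<Longrightarrow> \<exists>x y. e = {x, y} \<and> x \<noteq> y \<and> x \<in> V \<and> y \<in> V"
    and "\<And>C. \<not> circ E C"
  shows "card E < card V"
proof -
  have "E \<subseteq> Pow V" using assms(3) by blast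
  then have fE: "finite E" using assms(1) finite_subset by blast
  have "Pow E \<subseteq> cut E ` Pow (V - {r})"
  proof
    fix D assume D: "D \<in> Pow E"
    have "\<exists>X. D = cut E X"
      by (rule even_imp_cut) (use fE assms D in blast)+
    then obtain X where X: "D = cut E X" by blast
    \<comment> \<open>Either side describes the same cut; taking the one that misses
      \<open>r\<close> reduces the exponent to \<open>card V - 1\<close>.\<close>
    define Y where "Y = (if r \<in> X then V - X else X \<inter> V)"
    have "e \<in> cut E X \<longleftrightarrow> e \<in> cut E Y" if "e \<in> E" for e
    proof -
      obtain x y where "e = {x, y}" "x \<in> V" "y \<in> V" using assms(3) \<open>e \<in> E\<close> by blast
      then show ?thesis unfolding Y_def by auto
    qed
    then have "D = cut E Y" using X cut_subset[of E X] cut_subset[of E Y] by auto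
    moreover have "Y \<in> Pow (V - {r})" unfolding Y_def by auto
    ultimately show "D \<in> cut E ` Pow (V - {r})" by blast
  qed
  then have "card (Pow E) \<le> card (cut E ` Pow (V - {r}))"
    by (rule card_mono[rotated]) (use assms(1) in simp)
  also have "\<dots> \<le> card (Pow (V - {r}))" by (rule card_image_le) (use assms(1) in simp)
  finally have "card E \<le> card (V - {r})" using fE assms(1) by (simp add: card_Pow)
  then show ?thesis using assms(1,2) by (metis card_Diff1_less le_less_trans)
qed

section \<open>Agreement of \<open>circ\<close> with the circuits given by vertex lists\<close>

fun list_edges :: "'a list \<Rightarrow> 'a set set" where
  "list_edges (x # y # zs) = insert {x, y} (list_edges (y # zs))"
| "list_edges _ = {}"

lemma list_edges_conv: "list_edges xs = {{xs ! i, xs ! Suc i} | i. Suc i < length xs}"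
proof (induction xs rule: list_edges.induct)
  case (1 x y zs)
  have "{{(x # y # zs) ! i, (x # y # zs) ! Suc i} | i. Suc i < length (x # y # zs)} =
    insert {x, y} {{(y # zs) ! i, (y # zs) ! Suc i} | i. Suc i < length (y # zs)}" (is "?L = insert _ ?R")
  proof (intro equalityI subsetI)
    fix e assume "e \<in> ?L"
    then obtain i where i: "e = {(x # y # zs) ! i, (x # y # zs) ! Suc i}" "Suc i < length (x # y # zs)" by blast
    then show "e \<in> insert {x, y} ?R" by (cases i) auto
  next
    fix e assume "e \<in> insert {x, y} ?R"
    then consider "e = {x, y}" | i where "e = {(y # zs) ! i, (y # zs) ! Suc i}" "Suc i < length (y # zs)" by blast
    then show "e \<in> ?L"
    proof cases
      case 1 then show ?thesis by (intro CollectI exI[of _ 0]) auto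
    next
      case (2 i) then show ?thesis by (intro CollectI exI[of _ "Suc i"]) auto
    qed
  qed
  then show ?case using 1 by simp
qed auto

lemma cycle_edges_conv:
  assumes "xs \<noteq> []"
  shows "cycle_edges xs = insert {hd xs, last xs} (list_edges xs)"
proof -
  have *: "i < length xs \<longleftrightarrow> Suc i < length xs \<or> i = length xs - 1" for i using assms by (cases xs) auto
  have "{xs ! (length xs - 1), xs ! ((length xs - 1 + 1) mod length xs)} = {hd xs, last xs}"
    using assms by (auto simp: hd_conv_nth last_conv_nth)
  then show ?thesis
    unfolding cycle_edges_def list_edges_conv
    by (subst *) auto
qed

lemma gpath_list: "gpath E a S F b \<Longrightarrow>
    \<exists>xs. xs \<noteq> [] \<and> hd xs = a \<and> last xs = b \<and> distinct xs \<and> set xs = S \<and> list_edges xs = F"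
proof (induction rule: gpath.induct)
  case (gpath_refl a)
  show ?case by (rule exI[of _ "[a]"]) auto
next
  case (gpath_step a c S F b)
  then obtain xs where xs: "xs \<noteq> []" "hd xs = c" "last xs = b" "distinct xs" "set xs = S" "list_edges xs = F" by blast
  then obtain ys where "xs = c # ys" by (cases xs) auto
  then show ?case using xs gpath_step by (intro exI[of _ "a # xs"]) auto
qed

lemma list_gpath: "xs \<noteq> [] \<Longrightarrow> distinct xs \<Longrightarrow> list_edges xs \<subseteq> E \<Longrightarrow>
    gpath E (hd xs) (set xs) (list_edges xs) (last xs)"
proof (induction xs rule: list_edges.induct)
  case (1 x y zs)
  then show ?case using gpath_step[of x y E "set (y # zs)" "list_edges (y # zs)"] by auto
qed (auto intro: gpath_refl)

lemma is_circuit_iff_circ: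
  assumes "simple_graph V E"
  shows "is_circuit V E C \<longleftrightarrow> circ E C"
proof
  assume "is_circuit V E C"
  then obtain vs where vs: "length vs \<ge> 3" "distinct vs" "cycle_edges vs \<subseteq> E" "C = cycle_edges vs"
    unfolding is_circuit_def by blast
  then have ne: "vs \<noteq> []" by auto
  have "gpath E (hd vs) (set vs) (list_edges vs) (last vs)"
    by (rule list_gpath) (use vs ne cycle_edges_conv in auto)
  moreover have "3 \<le> card (set vs)" using vs distinct_card by metis
  moreover have "C = insert {hd vs, last vs} (list_edges vs)" "{hd vs, last vs} \<in> E"
    using vs cycle_edges_conv[OF ne] by auto
  ultimately show "circ E C" unfolding circ_def by blast
next
  assume "circ E C"
  then obtain a b S F where C: "gpath E a S F b" "{a, b} \<in> E" "3 \<le> card S" "C = insert {a, b} F"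
    unfolding circ_def by metis
  obtain xs where xs: "xs \<noteq> []" "hd xs = a" "last xs = b" "distinct xs" "set xs = S" "list_edges xs = F"
    using gpath_list[OF C(1)] by blast
  have V: "e \<subseteq> V" if e: "e \<in> E" for e
  proof -
    obtain u v where "e = {u, v}" "u \<in> V" "v \<in> V" using assms e unfolding simple_graph_def by meson
    then show ?thesis by simp
  qed
  have "S \<subseteq> V" using gpath_verts[OF C(1)] gpath_subset[OF C(1)] V V[OF C(2)] by blast
  moreover have "cycle_edges xs = C" using cycle_edges_conv[OF xs(1)] xs C by simp
  moreover have "length xs \<ge> 3" using xs C distinct_card by metis
  moreover have "C \<subseteq> E" using gpath_subset[OF C(1)] C by auto
  ultimately show "is_circuit V E C" unfolding is_circuit_def using xs by metis
qed

section \<open>Three-connected graphs\<close>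
lemma card_ge_3:
  assumes "finite S" "{x, y, z} \<subseteq> S" "x \<noteq> y" "x \<noteq> z" "y \<noteq> z"
  shows "3 \<le> card S"
proof -
  have "card {x, y, z} = 3" using assms by simp
  then show ?thesis using card_mono[OF assms(1,2)] by simp
qed

lemma two_vertices_avoid:
  assumes "x \<noteq> y" "{x, y} \<subseteq> A"
  shows "\<exists>a\<in>A. a \<noteq> z"
  using assms by (cases "x = z") auto

lemma card_pair_le: "card {x, y} \<le> 2"
  by (simp add: card_insert_if)

text \<open>Two disjoint paths between the ends of \<open>e1\<close> and the ends of
  \<open>e2\<close> are closed to a circuit by the two edges. Connectivity is demanded only between
  vertices of \<open>\<Union>E\<close>, so the lemma applies to \<open>G\<close> and to its
  vertex-deleted subgraphs without carrying a vertex set.\<close>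

lemma circ_through_edges:
  assumes fin: "finite E" and pair: "\<And>e. e \<in> E \<Longrightarrow> \<exists>x y. e = {x, y} \<and> x \<noteq> y"
    and con: "\<And>z u w. u \<in> \<Union>E \<Longrightarrow> w \<in> \<Union>E \<Longrightarrow> u \<noteq> z \<Longrightarrow> w \<noteq> z \<Longrightarrow> \<exists>S F. gpath E u S F w \<and> z \<notin> S"
    and e: "e1 \<in> E" "e2 \<in> E" "e1 \<noteq> e2"
  shows "\<exists>C. circ E C \<and> e1 \<in> C \<and> e2 \<in> C"
proof -
  obtain a b where ab: "e1 = {a, b}" "a \<noteq> b" using pair e by blast
  obtain c d where cd: "e2 = {c, d}" "c \<noteq> d" using pair e by blast
  have "two_paths E e1 {c, d}"
  proof (rule menger2[OF fin])
    show "\<exists>x y. e = {x, y}" if "e \<in> E" for e using pair[OF that] by blast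
    fix z
    obtain u where u: "u \<in> e1" "u \<noteq> z" using two_vertices_avoid[OF ab(2)] ab(1) by blast
    obtain w where w: "w \<in> {c, d}" "w \<noteq> z" using two_vertices_avoid[OF cd(2)] by blast
    have "\<exists>S F. gpath E u S F w \<and> z \<notin> S" by (rule con) (use u w e cd in auto)
    then show "\<exists>a\<in>e1. \<exists>b\<in>{c, d}. \<exists>S F. gpath E a S F b \<and> z \<notin> S" using u w by blast
  qed
  then obtain a1 a2 S1 S2 F1 F2 where p: "a1 \<in> e1" "a2 \<in> e1" "gpath E a1 S1 F1 c" "gpath E a2 S2 F2 d" "S1 \<inter> S2 = {}"
    using two_paths_pair by metis
  have m: "a1 \<in> S1" "a2 \<in> S2" "c \<in> S1" "d \<in> S2"
    using gpath_start[OF p(3)] gpath_start[OF p(4)] gpath_end[OF p(3)] gpath_end[OF p(4)] by auto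
  then have "a1 \<noteq> a2" using p by auto
  then have e1: "e1 = {a1, a2}" using p ab by auto
  have 1: "gpath E c (S1 \<union> S2) (insert {a1, a2} (F1 \<union> F2)) d"
    by (rule gpath_join_edge[OF gpath_rev[OF p(3)] p(4)]) (use e e1 p in auto)
  have "3 \<le> card (S1 \<union> S2)"
  proof -
    have f: "finite (S1 \<union> S2)" by (rule gpath_finite[OF 1])
    have "a1 \<noteq> c \<or> a2 \<noteq> d" using e e1 cd by auto
    then show ?thesis
    proof
      assume "a1 \<noteq> c"
      then show ?thesis using m p(5) by (intro card_ge_3[OF f, of a1 c d]) auto
    next
      assume "a2 \<noteq> d"
      then show ?thesis using m p(5) by (intro card_ge_3[OF f, of a2 c d]) auto
    qed
  qed
  then have "circ E (insert {c, d} (insert {a1, a2} (F1 \<union> F2)))"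
    unfolding circ_def using 1 e cd by blast
  then show ?thesis using e1 cd by blast
qed

text \<open>Two disjoint paths lead from the ends of \<open>g\<close> to \<open>C\<close>; each is
  stopped at its first vertex on \<open>C\<close>, and \<open>g\<close> joins them.\<close>

lemma circ_ear:
  assumes fin: "finite E" and pair: "\<And>e. e \<in> E \<Longrightarrow> \<exists>x y. e = {x, y} \<and> x \<noteq> y"
    and con: "\<And>z u w. u \<in> \<Union>E \<Longrightarrow> w \<in> \<Union>E \<Longrightarrow> u \<noteq> z \<Longrightarrow> w \<noteq> z \<Longrightarrow> \<exists>S F. gpath E u S F w \<and> z \<notin> S"
    and C: "circ E C" and g: "g \<in> E" "g \<notin> C"
  obtains p q S F where "gpath E p S F q" "p \<noteq> q" "S \<inter> \<Union>C = {p, q}" "g \<in> F" "F \<inter> C = {}"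
proof -
  obtain a b where ab: "g = {a, b}" "a \<noteq> b" using pair g by blast
  obtain e where e: "e \<in> C" using circ_nonempty[OF C] by auto
  obtain c d where cd: "e = {c, d}" "c \<noteq> d" using pair e circ_subset[OF C] by blast
  have "two_paths E g (\<Union>C)"
  proof (rule menger2[OF fin])
    show "\<exists>x y. e = {x, y}" if "e \<in> E" for e using pair[OF that] by blast
    fix z
    obtain u where u: "u \<in> g" "u \<noteq> z" using two_vertices_avoid[OF ab(2)] ab(1) by blast
    obtain w where w: "w \<in> e" "w \<noteq> z" using two_vertices_avoid[OF cd(2)] cd by blast
    have "\<exists>S F. gpath E u S F w \<and> z \<notin> S" by (rule con) (use u w g e circ_subset[OF C] in auto)
    then show "\<exists>a\<in>g. \<exists>b\<in>\<Union>C. \<exists>S F. gpath E a S F b \<and> z \<notin> S" using u w e by blast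
  qed
  then obtain a1 a2 b1 b2 S1 S2 F1 F2 where p: "a1 \<in> g" "a2 \<in> g" "b1 \<in> \<Union>C" "b2 \<in> \<Union>C"
      "gpath E a1 S1 F1 b1" "gpath E a2 S2 F2 b2" "S1 \<inter> S2 = {}"
    unfolding two_paths_def insert_subset by metis
  obtain T1 G1 q1 where 1: "gpath E a1 T1 G1 q1" "T1 \<inter> \<Union>C = {q1}" "T1 \<subseteq> S1"
    using gpath_first_hit[OF p(5,3)] by metis
  obtain T2 G2 q2 where 2: "gpath E a2 T2 G2 q2" "T2 \<inter> \<Union>C = {q2}" "T2 \<subseteq> S2"
    using gpath_first_hit[OF p(6,4)] by metis
  have m: "a1 \<in> T1" "a2 \<in> T2" "q1 \<in> T1" "q2 \<in> T2"
    using gpath_start[OF 1(1)] gpath_start[OF 2(1)] gpath_end[OF 1(1)] gpath_end[OF 2(1)] by auto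
  have dis: "T1 \<inter> T2 = {}" using 1 2 p by blast
  then have "a1 \<noteq> a2" "q1 \<noteq> q2" using m by auto
  then have ga: "g = {a1, a2}" using p ab by auto
  have j: "gpath E q1 (T1 \<union> T2) (insert {a1, a2} (G1 \<union> G2)) q2" (is "gpath E q1 ?S ?F q2")
    by (rule gpath_join_edge[OF gpath_rev[OF 1(1)] 2(1) _ dis]) (use g ga in auto)
  have i: "?S \<inter> \<Union>C = {q1, q2}" using 1 2 by auto
  \<comment> \<open>An edge of the ear that belonged to \<open>C\<close> would have both ends on
    \<open>C\<close>, so it would join the two ends of the ear and be the whole ear. It would then
    be \<open>g\<close>, which is not in \<open>C\<close>.\<close>
  have "?F \<inter> C = {}"
  proof (rule ccontr)
    assume "?F \<inter> C \<noteq> {}"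
    then obtain h where h: "h \<in> ?F" "h \<in> C" by blast
    have "h \<subseteq> ?S" by (rule gpath_edge_subset[OF j h(1)])
    then have "h \<subseteq> {q1, q2}" using i h(2) by blast
    moreover have "card h = 2" by (rule gpath_card_edge[OF j h(1)])
    ultimately have "h = {q1, q2}" using \<open>q1 \<noteq> q2\<close> by (metis card_2_iff card_subset_eq finite.emptyI finite.insertI)
    then have "?F = {h}" using gpath_end_edge[OF j] h(1) by auto
    then show False using g h ga by auto
  qed
  then show thesis using that[OF j \<open>q1 \<noteq> q2\<close> i] ga by blast
qed

lemma gpath_edge_disjoint:
  assumes "gpath E x S F m" "gpath E x T G m" "S \<inter> T = {x, m}" "x \<noteq> m" "F \<noteq> G"
  shows "F \<inter> G = {}"
proof (rule ccontr)
  assume "F \<inter> G \<noteq> {}"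
  then obtain g where g: "g \<in> F" "g \<in> G" by blast
  have "g \<subseteq> {x, m}" using gpath_edge_subset[OF assms(1) g(1)] gpath_edge_subset[OF assms(2) g(2)] assms(3) by blast
  moreover have "card g = 2" by (rule gpath_card_edge[OF assms(1) g(1)])
  ultimately have "g = {x, m}" using assms(4) by (metis card_2_iff card_subset_eq finite.emptyI finite.insertI)
  then have "F = {g}" "G = {g}" using gpath_end_edge[OF assms(1)] gpath_end_edge[OF assms(2)] g by auto
  then show False using assms by simp
qed

lemma even_card_sym_diff:
  assumes "finite P" "finite Q" "even (card P)" "even (card Q)"
  shows "even (card ((P - Q) \<union> (Q - P)))"
proof -
  have "card ((P - Q) \<union> (Q - P)) = card (P - Q) + card (Q - P)"
    by (rule card_Un_disjoint) (use assms in auto)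
  moreover have "card P = card (P - Q) + card (P \<inter> Q)" "card Q = card (Q - P) + card (P \<inter> Q)"
    using assms by (simp_all add: card_Diff_subset_Int card_mono Int_commute)
  ultimately show ?thesis using assms(3,4) by presburger
qed

text \<open>The map \<open>h\<close> allows one count to serve both graphs: it is the identity for
  \<open>G\<close>, and it is \<open>f\<close> when edges of \<open>G\<close> are counted at the
  vertices of \<open>G'\<close>.\<close>

lemma double_count:
  assumes "finite V" "finite E" "\<And>e. e \<in> E \<Longrightarrow> card (V \<inter> h e) = 2"
  shows "(\<Sum>v\<in>V. card {e \<in> E. v \<in> h e}) = 2 * card E"
proof -
  have "(\<Sum>v\<in>V. card {e \<in> E. v \<in> h e}) = (\<Sum>v\<in>V. \<Sum>e | e \<in> E \<and> v \<in> h e. 1)" by simp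
  also have "\<dots> = (\<Sum>e\<in>E. \<Sum>v | v \<in> V \<and> v \<in> h e. 1)"
    by (rule sum.swap_restrict) (use assms in auto)
  also have "\<dots> = (\<Sum>e\<in>E. 2)"
  proof (rule sum.cong)
    fix e assume "e \<in> E"
    moreover have "{v. v \<in> V \<and> v \<in> h e} = V \<inter> h e" by auto
    ultimately show "(\<Sum>v | v \<in> V \<and> v \<in> h e. 1) = (2::nat)" using assms(3) by simp
  qed simp
  finally show ?thesis by simp
qed

section \<open>Consequences of 3-connectivity for paths, circuits and cuts\<close>

locale three_connected_graph =
  fixes V :: "'a set" and E :: "'a set set"
  assumes simple: "simple_graph V E" and finite_V: "finite V" and three_connected: "k_connected 3 V E"
begin

lemma edgeE:
  assumes "e \<in> E"
  obtains x y where "e = {x, y}" "x \<noteq> y" "x \<in> V" "y \<in> V"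
  using assms simple unfolding simple_graph_def by meson

lemma pair: "e \<in> E \<Longrightarrow> \<exists>x y. e = {x, y} \<and> x \<noteq> y"
  using edgeE by metis

lemma edge_subset: "e \<in> E \<Longrightarrow> e \<subseteq> V"
  by (elim edgeE) simp

lemma finite_E: "finite E"
  by (rule finite_subset[of _ "Pow V"]) (use edge_subset finite_V in auto)

lemma card_V: "3 < card V"
  using three_connected unfolding k_connected_def by simp

lemma connected_avoiding:
  assumes "finite Z" "card Z \<le> 2" "u \<in> V - Z" "w \<in> V - Z"
  shows "\<exists>S F. gpath (del_verts_E E Z) u S F w \<and> S \<inter> Z = {}"
proof -
  have "card (Z \<inter> V) < 3" using assms card_mono[of Z "Z \<inter> V"] by simp
  then have "graph_connected (V - Z \<inter> V) (del_verts_E E (Z \<inter> V))"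
    using three_connected assms(1) unfolding k_connected_def by auto
  then have "(u, w) \<in> {(x, y). {x, y} \<in> del_verts_E E (Z \<inter> V)}\<^sup>*"
    using assms unfolding graph_connected_def by blast
  moreover have "del_verts_E E (Z \<inter> V) = del_verts_E E Z"
    using edge_subset unfolding del_verts_E_def by blast
  ultimately obtain S F where p: "gpath (del_verts_E E Z) u S F w" using gpath_of_rtrancl by metis
  have "S \<inter> Z = {}" using gpath_verts[OF p] gpath_subset[OF p] assms unfolding del_verts_E_def by blast
  then show ?thesis using p by blast
qed

lemma del_verts_subset: "del_verts_E E Z \<subseteq> E"
  by (auto simp: del_verts_E_def)

lemma gpath_avoiding:
  assumes "finite Z" "card Z \<le> 2" "u \<in> V - Z" "w \<in> V - Z"
  shows "\<exists>S F. gpath E u S F w \<and> S \<inter> Z = {}"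
  using connected_avoiding[OF assms] gpath_supergraph[OF _ del_verts_subset] by metis

lemma two_connected_del:
  assumes "u \<in> \<Union>(del_verts_E E {c})" "w \<in> \<Union>(del_verts_E E {c})" "u \<noteq> z" "w \<noteq> z"
  shows "\<exists>S F. gpath (del_verts_E E {c}) u S F w \<and> z \<notin> S"
proof -
  have "u \<in> V - {c, z}" "w \<in> V - {c, z}" using assms edge_subset unfolding del_verts_E_def by auto
  then obtain S F where p: "gpath (del_verts_E E {c, z}) u S F w" "S \<inter> {c, z} = {}"
    using connected_avoiding[OF _ card_pair_le[of c z], of u w] by auto
  then have "gpath (del_verts_E E {c}) u S F w"
    by (intro gpath_supergraph[OF p(1)]) (auto simp: del_verts_E_def)
  then show ?thesis using p by blast
qed

lemma circ_through_edges_avoiding: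
  assumes "e1 \<in> E" "e2 \<in> E" "e1 \<noteq> e2" "c \<notin> e1" "c \<notin> e2"
  shows "\<exists>C. circ E C \<and> e1 \<in> C \<and> e2 \<in> C \<and> c \<notin> \<Union>C"
proof -
  have "\<exists>C. circ (del_verts_E E {c}) C \<and> e1 \<in> C \<and> e2 \<in> C"
  proof (rule circ_through_edges[OF _ _ two_connected_del])
    show "finite (del_verts_E E {c})" by (rule finite_subset[OF del_verts_subset finite_E])
    show "\<exists>x y. e = {x, y} \<and> x \<noteq> y" if "e \<in> del_verts_E E {c}" for e
      using that del_verts_subset pair by blast
  qed (use assms in \<open>auto simp: del_verts_E_def\<close>)
  then obtain C where C: "circ (del_verts_E E {c}) C" "e1 \<in> C" "e2 \<in> C" by blast
  have "circ E C" by (rule circ_supergraph[OF C(1) del_verts_subset])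
  moreover have "c \<notin> \<Union>C" using circ_subset[OF C(1)] unfolding del_verts_E_def by blast
  ultimately show ?thesis using C by blast
qed

lemma two_connected:
  assumes "u \<in> \<Union>E" "w \<in> \<Union>E" "u \<noteq> z" "w \<noteq> z"
  shows "\<exists>S F. gpath E u S F w \<and> z \<notin> S"
proof -
  have "u \<in> V - {z}" "w \<in> V - {z}" using assms edge_subset by auto
  then show ?thesis using gpath_avoiding[of "{z}" u w] by auto
qed

lemma circ_through: "e1 \<in> E \<Longrightarrow> e2 \<in> E \<Longrightarrow> e1 \<noteq> e2 \<Longrightarrow> \<exists>C. circ E C \<and> e1 \<in> C \<and> e2 \<in> C"
  by (rule circ_through_edges[OF finite_E pair two_connected])

lemma ear:
  assumes "circ E C" "g \<in> E" "g \<notin> C"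
  obtains p q S F where "gpath E p S F q" "p \<noteq> q" "S \<inter> \<Union>C = {p, q}" "g \<in> F" "F \<inter> C = {}"
  by (rule circ_ear[OF finite_E pair two_connected assms])

lemma cut_edgeE:
  assumes "e \<in> cut E X"
  obtains x y where "e = {x, y}" "x \<in> V \<inter> X" "y \<in> V - X"
proof -
  have "e \<in> E" using assms cut_subset by blast
  then obtain x y where xy: "e = {x, y}" "x \<noteq> y" "x \<in> V" "y \<in> V" by (rule edgeE)
  then have "(x \<in> X) \<noteq> (y \<in> X)" using assms by simp
  then show thesis using that[of x y] that[of y x] xy by (cases "x \<in> X") auto
qed

text \<open>A path from \<open>p\<close> to \<open>q\<close> that avoids \<open>Z\<close> has to
  cross the cut, and the crossing edge avoids \<open>Z\<close> as well.\<close>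

lemma cut_nonempty:
  assumes "X \<subseteq> V" "X \<noteq> {}" "X \<noteq> V" "finite Z" "card Z \<le> 2" "p \<in> X - Z" "q \<in> V - X - Z"
  shows "\<exists>x y. {x, y} \<in> cut E X \<and> x \<in> X - Z \<and> y \<in> V - X - Z"
proof -
  obtain S F where p: "gpath E p S F q" "S \<inter> Z = {}" using gpath_avoiding[of Z p q] assms by auto
  have "odd (card (F \<inter> cut E X))" using gpath_cut_parity[OF p(1), of E X] assms by auto
  then have "F \<inter> cut E X \<noteq> {}" by auto
  then obtain e where e: "e \<in> F" "e \<in> cut E X" by blast
  obtain x y where xy: "e = {x, y}" "x \<in> V \<inter> X" "y \<in> V - X" using e(2) by (rule cut_edgeE)
  have "x \<notin> Z" "y \<notin> Z" using gpath_edge_subset[OF p(1) e(1)] p(2) xy by auto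
  then show ?thesis using e xy by auto
qed

text \<open>If two edges made up the whole cut, deleting one end of each would leave no crossing
  edge, against \<open>cut_nonempty\<close>; the ends must be chosen so that both sides keep a
  vertex. A cut with only one edge is covered by taking the two edges equal.\<close>

lemma card_cut:
  assumes X: "X \<subseteq> V" "X \<noteq> {}" "X \<noteq> V"
  shows "3 \<le> card (cut E X)"
proof (rule ccontr)
  assume "\<not> 3 \<le> card (cut E X)"
  then have le: "card (cut E X) \<le> 2" by simp
  have fin: "finite (cut E X)" by (rule finite_subset[OF cut_subset finite_E])
  obtain p0 q0 where pq: "p0 \<in> X" "q0 \<in> V - X" using X by auto
  obtain x1 y1 where e1: "{x1, y1} \<in> cut E X" "x1 \<in> X" "y1 \<in> V - X"
    using cut_nonempty[OF X, of "{}" p0 q0] pq by auto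
  have "\<exists>x2 y2. {x2, y2} \<in> cut E X \<and> x2 \<in> X \<and> y2 \<in> V - X \<and> cut E X \<subseteq> {{x1, y1}, {x2, y2}}"
  proof (cases "cut E X \<subseteq> {{x1, y1}}")
    case True
    then show ?thesis using e1 by blast
  next
    case False
    then obtain e where e: "e \<in> cut E X" "e \<noteq> {x1, y1}" by blast
    obtain x y where xy: "e = {x, y}" "x \<in> V \<inter> X" "y \<in> V - X" using e(1) by (rule cut_edgeE)
    have "card {{x1, y1}, e} = 2" using e by simp
    then have "{{x1, y1}, e} = cut E X" using card_seteq[OF fin, of "{{x1, y1}, e}"] e e1 le by auto
    then show ?thesis using xy e by blast
  qed
  then obtain x2 y2 where e2: "{x2, y2} \<in> cut E X" "x2 \<in> X" "y2 \<in> V - X" and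
    sub: "cut E X \<subseteq> {{x1, y1}, {x2, y2}}" by blast
  have key: False if z: "p \<in> X - {z1, z2}" "q \<in> V - X - {z1, z2}" "z1 \<in> {x1, y1}" "z2 \<in> {x2, y2}" for p q z1 z2
  proof -
    obtain x y where "{x, y} \<in> cut E X" "x \<in> X - {z1, z2}" "y \<in> V - X - {z1, z2}"
      using cut_nonempty[OF X _ card_pair_le[of z1 z2] z(1,2)] by blast
    then have "{x, y} = {x1, y1} \<or> {x, y} = {x2, y2}" using sub by blast
    then have "z1 \<in> {x, y} \<or> z2 \<in> {x, y}" using z(3,4) by blast
    then show False using \<open>x \<in> _\<close> \<open>y \<in> _\<close> by blast
  qed
  \<comment> \<open>If \<open>X\<close> has a further vertex, both ends in \<open>X\<close> are
    deleted, and likewise for \<open>V - X\<close>. Otherwise \<open>V\<close> consists of these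
    four vertices, which are distinct because \<open>V\<close> has more than three elements; then
    \<open>y1\<close> and \<open>x2\<close> are deleted, and \<open>x1\<close> and \<open>y2\<close>
    remain.\<close>
  consider p where "p \<in> X - {x1, x2}" | q where "q \<in> V - X - {y1, y2}" | "V \<subseteq> {x1, x2, y1, y2}"
    using X by blast
  then show False
  proof cases
    case (1 p) then show False using key[of p x1 x2 y1] e1 e2 by auto
  next
    case (2 q) then show False using key[of x1 y1 y2 q] e1 e2 by auto
  next
    case 3
    then have "4 \<le> card {x1, x2, y1, y2}" using card_mono[OF _ 3] card_V by simp
    then have "x1 \<noteq> x2" "y1 \<noteq> y2" by (auto simp: card_insert_if split: if_splits)
    then show False using key[of x1 y1 x2 y2] e1 e2 by auto
  qed
qed

lemma cut_singleton: "cut E {v} = {e \<in> E. v \<in> e}"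
  by (rule cut_eq_star) (rule pair)

lemma degree: "v \<in> V \<Longrightarrow> 3 \<le> card {e \<in> E. v \<in> e}"
  using card_cut[of "{v}"] card_V unfolding cut_singleton by fastforce

lemma handshake: "(\<Sum>v\<in>V. card {e \<in> E. v \<in> e}) = 2 * card E"
proof (rule double_count[OF finite_V finite_E])
  fix e assume "e \<in> E"
  then obtain x y where "e = {x, y}" "x \<noteq> y" "x \<in> V" "y \<in> V" by (rule edgeE)
  then have "V \<inter> e = {x, y}" by auto
  then show "card (V \<inter> e) = 2" using \<open>x \<noteq> y\<close> by simp
qed

lemma card_E: "3 * card V \<le> 2 * card E"
proof -
  have "(\<Sum>v\<in>V. 3) \<le> (\<Sum>v\<in>V. card {e \<in> E. v \<in> e})" by (rule sum_mono) (rule degree)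
  then show ?thesis using handshake by (simp add: mult.commute)
qed

text \<open>The vertices still reachable from \<open>u\<close> would otherwise be one side of a cut
  contained in \<open>{e, e'}\<close>, against \<open>card_cut\<close>.\<close>

lemma gpath_avoiding_edges:
  assumes "u \<in> V" "w \<in> V"
  shows "\<exists>S F. gpath (E - {e, e'}) u S F w"
proof (rule ccontr)
  assume no: "\<nexists>S F. gpath (E - {e, e'}) u S F w"
  define K where "K = {v \<in> V. \<exists>S F. gpath (E - {e, e'}) u S F v}"
  have "u \<in> K" unfolding K_def using gpath_refl[of _ u] assms by blast
  moreover have "w \<notin> K" unfolding K_def using no by blast
  moreover have "K \<subseteq> V" unfolding K_def by blast
  ultimately have "3 \<le> card (cut E K)" using assms by (intro card_cut) auto
  moreover have "cut E K \<subseteq> {e, e'}"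
  proof
    fix g assume g: "g \<in> cut E K"
    then have "g \<in> E" using cut_subset by blast
    then obtain x y where xy: "g = {x, y}" "x \<in> V" "y \<in> V" by (rule edgeE)
    have *: "v' \<in> K" if u: "u' \<in> K" "{u', v'} \<in> E - {e, e'}" "v' \<in> V" for u' v'
    proof -
      obtain S F where S: "gpath (E - {e, e'}) u S F u'" using u unfolding K_def by blast
      have "(u', v') \<in> {(x, y). {x, y} \<in> E - {e, e'}}\<^sup>*" using u by auto
      then obtain T G where "gpath (E - {e, e'}) u' T G v'" using gpath_of_rtrancl by metis
      then obtain S' F' where "gpath (E - {e, e'}) u S' F' v'" using gpath_trans[OF S] by metis
      then show ?thesis using u unfolding K_def by auto
    qed
    show "g \<in> {e, e'}"
      using *[of x y] *[of y x] g xy \<open>g \<in> E\<close> by (auto simp: insert_commute)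
  qed
  then have "card (cut E K) \<le> card {e, e'}" by (rule card_mono[rotated]) simp
  moreover have "card {e, e'} \<le> 2" by (rule card_pair_le)
  ultimately show False by simp
qed

end

section \<open>Injectivity\<close>
lemma inter_part:
  assumes "P \<inter> X = {a, b}" "Q \<subseteq> P"
  shows "a \<in> Q \<Longrightarrow> b \<notin> Q \<Longrightarrow> Q \<inter> X = {a}" and "a \<notin> Q \<Longrightarrow> b \<in> Q \<Longrightarrow> Q \<inter> X = {b}"
proof -
  have "Q \<inter> X = Q \<inter> {a, b}" using assms by blast
  then show "a \<in> Q \<Longrightarrow> b \<notin> Q \<Longrightarrow> Q \<inter> X = {a}" and "a \<notin> Q \<Longrightarrow> b \<in> Q \<Longrightarrow> Q \<inter> X = {b}" by auto
qed

locale circuit_map = three_connected_graph V E for V :: "'a set" and E :: "'a set set" +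
  fixes V' :: "'b set" and E' :: "'b set set" and f :: "'a set \<Rightarrow> 'b set"
  assumes simple': "simple_graph V' E'" and no_isolated: "no_isolated_vertices V' E'"
    and circuit_surjection: "circuit_surjection V E V' E' f"
begin

lemma image_E: "f ` E = E'"
  using circuit_surjection unfolding circuit_surjection_def by simp

lemma circ_image: "circ E C \<Longrightarrow> circ E' (f ` C)"
  using circuit_surjection is_circuit_iff_circ[OF simple] is_circuit_iff_circ[OF simple']
  unfolding circuit_surjection_def by blast

text \<open>If the three circuits of a theta graph have distinct images, then the symmetric difference of
  two of the images is an even subset of the third, hence equal to it by minimality of circuits; so
  the images of the three paths are pairwise disjoint.\<close>
lemma theta_image:
  assumes "circ E (F1 \<union> F2)" "circ E (F1 \<union> F3)" "circ E (F2 \<union> F3)"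
    and "e \<in> F1" "e' \<in> F2" "f e = f e'"
  shows "f ` (F1 \<union> F3) = f ` (F1 \<union> F2)"
proof (rule ccontr)
  assume ne: "f ` (F1 \<union> F3) \<noteq> f ` (F1 \<union> F2)"
  define P Q where "P = f ` (F1 \<union> F2)" and "Q = f ` (F1 \<union> F3)"
  define D where "D = (P - Q) \<union> (Q - P)"
  have P: "circ E' P" and Q: "circ E' Q" and R: "circ E' (f ` (F2 \<union> F3))"
    using circ_image assms unfolding P_def Q_def by blast+
  have "D = f ` (F2 \<union> F3)"
  proof (rule circ_minimal[OF R])
    show "D \<subseteq> f ` (F2 \<union> F3)" unfolding D_def P_def Q_def by blast
    show "D \<noteq> {}" using ne unfolding D_def P_def Q_def by blast
    fix w
    have "{e \<in> D. w \<in> e} = ({e \<in> P. w \<in> e} - {e \<in> Q. w \<in> e}) \<union> ({e \<in> Q. w \<in> e} - {e \<in> P. w \<in> e})"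
      unfolding D_def by auto
    also have "even (card \<dots>)"
      by (rule even_card_sym_diff) (use circ_finite[OF P] circ_finite[OF Q] in
          \<open>auto intro: circ_degree_even[OF P] circ_degree_even[OF Q]\<close>)
    finally show "even (card {e \<in> D. w \<in> e})" .
  qed
  then have "f e \<in> D" using assms by auto
  moreover have "f e \<in> P" "f e \<in> Q" using assms unfolding P_def Q_def by blast+
  ultimately show False unfolding D_def by blast
qed

text \<open>Edge disjointness of the three paths comes for free: paths with only their ends in
  common can share no edge but \<open>{m, x}\<close>, and then they coincide. The positions of
  \<open>e\<close> and \<open>e'\<close> exclude this.\<close>

lemma theta_paths_image:
  assumes p: "gpath E m S1 F1 x" "gpath E m S2 F2 x" "gpath E m S3 F3 x"
    and "S1 \<inter> S2 = {m, x}" "S1 \<inter> S3 = {m, x}" "S2 \<inter> S3 = {m, x}" "m \<noteq> x"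
    and e: "e \<in> F1" "e' \<in> F2" "e \<notin> F3" "e' \<notin> F3" "e \<noteq> e'" "f e = f e'"
  shows "f ` (F1 \<union> F3) = f ` (F1 \<union> F2)"
proof -
  have "F1 \<noteq> F2"
  proof
    assume F: "F1 = F2"
    have "S1 = S2"
    proof -
      have "S \<subseteq> T" if "gpath E m S F x" "gpath E m T F x" for S T F
        using gpath_verts[OF that(1)] gpath_start[OF that(2)] gpath_edge_subset[OF that(2)] by blast
      then show ?thesis using p F by blast
    qed
    then have "e \<subseteq> {m, x}" "e' \<subseteq> {m, x}" "card e = 2" "card e' = 2"
      using gpath_edge_subset[OF p(1) e(1)] gpath_edge_subset[OF p(2) e(2)] assms(4)
        gpath_card_edge[OF p(1) e(1)] gpath_card_edge[OF p(2) e(2)] by auto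
    moreover have "card {m, x} = 2" using \<open>m \<noteq> x\<close> by simp
    ultimately have "e = {m, x}" "e' = {m, x}" by (metis card_subset_eq finite.emptyI finite.insertI)+
    then have "e = e'" by metis
    then show False using e by simp
  qed
  then have d: "F1 \<inter> F2 = {}" "F1 \<inter> F3 = {}" "F2 \<inter> F3 = {}"
    using gpath_edge_disjoint p assms(4-7) e(1-4) by metis+
  have "circ E (F1 \<union> F2)" "circ E (F1 \<union> F3)" "circ E (F2 \<union> F3)"
    using circ_two_paths p assms(4-7) d by metis+
  then show ?thesis by (rule theta_image[OF _ _ _ e(1,2,6)])
qed

text \<open>The path \<open>a \<dots> x \<dots> u1 u2 \<dots> m \<dots> u3 u4 \<dots> b\<close> is closed to a circuit by the path \<open>SP\<close>;
  the path \<open>SR\<close> from \<open>x\<close> to \<open>m\<close> bypasses the edge \<open>e = u1 u2\<close>.\<close>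
lemma detour_image:
  assumes p: "gpath E a S1 G1 x" "gpath E x S2 G2 u1" "gpath E u2 S3 G3 m" "gpath E m S4 G4 u3"
      "gpath E u4 S5 G5 b" "gpath E a SP FP b" "gpath E x SR FR m"
    and e: "e = {u1, u2}" "e' = {u3, u4}" "e \<in> E" "e' \<in> E" "e \<noteq> e'" "f e = f e'" "e \<notin> FR" "e' \<notin> FR"
    and d: "S1 \<inter> S2 = {x}" "S3 \<inter> S4 = {m}" "(S1 \<union> S2) \<inter> (S3 \<union> S4) = {}" "(S1 \<union> S2) \<inter> S5 = {}"
      "(S3 \<union> S4) \<inter> S5 = {}" "SP \<inter> (S1 \<union> S2 \<union> S3 \<union> S4 \<union> S5) = {a, b}"
      "SR \<inter> (S1 \<union> S2 \<union> S3 \<union> S4 \<union> S5 \<union> SP) = {x, m}"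
  shows "f ` insert e (G2 \<union> G3 \<union> FR) = f ` insert e (insert e' (G1 \<union> G2 \<union> G3 \<union> G4 \<union> G5 \<union> FP))"
proof -
  have m: "a \<in> S1" "x \<in> S1" "x \<in> S2" "m \<in> S3" "m \<in> S4" "b \<in> S5" "a \<in> SP" "b \<in> SP"
    using p gpath_start gpath_end by metis+
  have "S2 \<inter> S3 = {}" using d(3) by blast
  then have t1: "gpath E x (S2 \<union> S3) (insert e (G2 \<union> G3)) m"
    using gpath_join_edge[OF p(2,3)] e by blast
  have "S1 \<inter> SP = {a}" using d(4,6) m by blast
  from gpath_append[OF gpath_rev[OF p(1)] p(6) this]
  have "gpath E x (S1 \<union> SP) (G1 \<union> FP) b" .
  moreover have "(S1 \<union> SP) \<inter> S5 = {b}"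
  proof -
    have "a \<notin> S5" using d(4) m by blast
    then show ?thesis using d(4,6) m by blast
  qed
  ultimately have "gpath E x (S1 \<union> SP \<union> S5) (G1 \<union> FP \<union> G5) u4"
    using gpath_append gpath_rev[OF p(5)] by metis
  moreover have "(S1 \<union> SP \<union> S5) \<inter> S4 = {}"
  proof -
    have "a \<notin> S4" "b \<notin> S4" using d(3,5) m by blast+
    moreover have "SP \<inter> S4 \<subseteq> {a, b}" using d(6) by blast
    ultimately have "SP \<inter> S4 = {}" by blast
    then show ?thesis using d(3,5) by blast
  qed
  ultimately have t2: "gpath E x (S1 \<union> SP \<union> S5 \<union> S4) (insert e' ((G1 \<union> FP \<union> G5) \<union> G4)) m"
    using gpath_join_edge[OF _ gpath_rev[OF p(4)]] e by (metis insert_commute)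
  have "f ` (insert e (G2 \<union> G3) \<union> FR) = f ` (insert e (G2 \<union> G3) \<union> insert e' ((G1 \<union> FP \<union> G5) \<union> G4))"
  proof (rule theta_paths_image[OF t1 t2 p(7), where e = e and e' = e'])
    have "SP \<inter> S2 \<subseteq> {x}" using d(1,4,6) m by blast
    moreover have "SP \<inter> S3 = {}"
    proof -
      have "a \<notin> S3" "b \<notin> S3" using d(3,5) m by blast+
      moreover have "SP \<inter> S3 \<subseteq> {a, b}" using d(6) by blast
      ultimately show ?thesis by blast
    qed
    moreover have "S2 \<inter> S1 = {x}" "S2 \<inter> S5 = {}" "S2 \<inter> S4 = {}" "S3 \<inter> S1 = {}" "S3 \<inter> S5 = {}" "S3 \<inter> S4 = {m}"
      using d(1-5) by blast+
    ultimately show "(S2 \<union> S3) \<inter> (S1 \<union> SP \<union> S5 \<union> S4) = {x, m}"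
      unfolding Int_Un_distrib Int_Un_distrib2 by auto
    show "(S2 \<union> S3) \<inter> SR = {x, m}" using d(7) m by blast
    show "(S1 \<union> SP \<union> S5 \<union> S4) \<inter> SR = {x, m}" using d(7) m by blast
    show "x \<noteq> m" using d(3) m by blast
  qed (use e(5-8) in auto)
  moreover have eq1: "insert e (G2 \<union> G3) \<union> FR = insert e (G2 \<union> G3 \<union> FR)" by blast
  moreover have eq2: "insert e (G2 \<union> G3) \<union> insert e' ((G1 \<union> FP \<union> G5) \<union> G4) =
    insert e (insert e' (G1 \<union> G2 \<union> G3 \<union> G4 \<union> G5 \<union> FP))" by blast
  ultimately show ?thesis by (simp only: eq1 eq2)
qed

text \<open>A path from \<open>a\<close> to \<open>b\<close> through two edges with the same image.\<close>
definition chain where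
  "chain a S1 G1 u1 u2 S2 G2 u3 u4 S3 G3 b \<longleftrightarrow> gpath E a S1 G1 u1 \<and> gpath E u2 S2 G2 u3 \<and>
     gpath E u4 S3 G3 b \<and> {u1, u2} \<in> E \<and> {u3, u4} \<in> E \<and> {u1, u2} \<noteq> {u3, u4} \<and>
     f {u1, u2} = f {u3, u4} \<and> S1 \<inter> S2 = {} \<and> S1 \<inter> S3 = {} \<and> S2 \<inter> S3 = {}"

lemma chain_rev:
  "chain a S1 G1 u1 u2 S2 G2 u3 u4 S3 G3 b \<Longrightarrow> chain b S3 G3 u4 u3 S2 G2 u2 u1 S1 G1 a"
  unfolding chain_def by (auto simp: insert_commute Int_commute intro: gpath_rev)

text \<open>The small circuit that the detour forms with the part of the chain from \<open>x\<close>
  to \<open>m\<close> uses neither \<open>FP\<close> nor \<open>FQ\<close>. By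
  \<open>detour_image\<close> both large circuits have the image of this small one.\<close>

lemma chain_detour_inner:
  assumes c: "chain a S1 G1 u1 u2 S2 G2 u3 u4 S3 G3 b"
    and p: "gpath E a SP FP b" "gpath E a SQ FQ b"
    and d: "SP \<inter> (S1 \<union> S2 \<union> S3) = {a, b}" "SQ \<inter> (S1 \<union> S2 \<union> S3) = {a, b}"
    and R: "gpath E x SR FR m" "x \<in> S1" "SR \<inter> (S1 \<union> S3 \<union> SP \<union> SQ) = {x}" "SR \<inter> S2 = {m}"
      "{u1, u2} \<notin> FR" "{u3, u4} \<notin> FR"
  shows "f ` (insert {u1, u2} (insert {u3, u4} (G1 \<union> G2 \<union> G3)) \<union> FP) =
         f ` (insert {u1, u2} (insert {u3, u4} (G1 \<union> G2 \<union> G3)) \<union> FQ)"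
proof -
  note c' = c[unfolded chain_def]
  have c1: "gpath E a S1 G1 u1" and c2: "gpath E u2 S2 G2 u3" and c3: "gpath E u4 S3 G3 b" using c' by auto
  have "m \<in> S2" using R(4) by blast
  obtain A1 B1 A2 B2 where A: "gpath E a A1 B1 x" "gpath E x A2 B2 u1" "S1 = A1 \<union> A2" "A1 \<inter> A2 = {x}" "G1 = B1 \<union> B2"
    using gpath_split[OF c1 R(2)] by metis
  obtain A3 B3 A4 B4 where B: "gpath E u2 A3 B3 m" "gpath E m A4 B4 u3" "S2 = A3 \<union> A4" "A3 \<inter> A4 = {m}" "G2 = B3 \<union> B4"
    using gpath_split[OF c2 \<open>m \<in> S2\<close>] by metis
  have c'': "{u1, u2} \<in> E" "{u3, u4} \<in> E" "{u1, u2} \<noteq> {u3, u4}" "f {u1, u2} = f {u3, u4}"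
    "S1 \<inter> S2 = {}" "S1 \<inter> S3 = {}" "S2 \<inter> S3 = {}" using c' by auto
  have *: "f ` insert {u1, u2} (B2 \<union> B3 \<union> FR) =
      f ` (insert {u1, u2} (insert {u3, u4} (B1 \<union> B2 \<union> B3 \<union> B4 \<union> G3 \<union> F)))"
    if S: "gpath E a S F b" "S \<inter> (S1 \<union> S2 \<union> S3) = {a, b}" "SR \<inter> (S1 \<union> S3 \<union> S) = {x}" for S F
  proof (rule detour_image[OF A(1,2) B(1,2) c3 S(1) R(1) refl refl c''(1-4) R(5,6)])
    show "A1 \<inter> A2 = {x}" "A3 \<inter> A4 = {m}" by fact+
    show "(A1 \<union> A2) \<inter> (A3 \<union> A4) = {}" "(A1 \<union> A2) \<inter> S3 = {}" "(A3 \<union> A4) \<inter> S3 = {}"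
      using c''(5-7) unfolding A(3) B(3) .
    show "S \<inter> (A1 \<union> A2 \<union> A3 \<union> A4 \<union> S3) = {a, b}" using S(2) unfolding A(3) B(3) by blast
    have "SR \<inter> (A1 \<union> A2 \<union> A3 \<union> A4 \<union> S3 \<union> S) = SR \<inter> (S1 \<union> S3 \<union> S) \<union> SR \<inter> S2"
      unfolding A(3) B(3) by blast
    then show "SR \<inter> (A1 \<union> A2 \<union> A3 \<union> A4 \<union> S3 \<union> S) = {x, m}" unfolding S(3) R(4) by auto
  qed
  have "SR \<inter> (S1 \<union> S3 \<union> SP) = {x}" "SR \<inter> (S1 \<union> S3 \<union> SQ) = {x}" using R(2,3) by blast+
  from *[OF p(1) d(1) this(1)] *[OF p(2) d(2) this(2)]
  show ?thesis using A(5) B(5) by (simp add: Un_assoc)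
qed

text \<open>Now the detour leaves from the interior of \<open>SP\<close>. In the circuit with
  \<open>SP\<close> the chain is prolonged backwards from \<open>a\<close> to \<open>x\<close>, so
  that \<open>x\<close> becomes its start. In the circuit with \<open>SQ\<close> the start stays at
  \<open>a\<close>, and the detour is prolonged instead, by the piece of \<open>SP\<close> from
  \<open>a\<close> to \<open>x\<close>. Both readings cut off the same small circuit, so the two
  images agree.\<close>

lemma chain_detour_side:
  assumes c: "chain a S1 G1 u1 u2 S2 G2 u3 u4 S3 G3 b"
    and p: "gpath E a SP FP b" "gpath E a SQ FQ b"
    and d: "SP \<inter> (S1 \<union> S2 \<union> S3) = {a, b}" "SQ \<inter> (S1 \<union> S2 \<union> S3) = {a, b}" "SP \<inter> SQ = {a, b}"
    and R: "gpath E x SR FR m" "x \<in> SP" "x \<notin> S1" "x \<notin> S3" "SR \<inter> (S1 \<union> S3 \<union> SP \<union> SQ) = {x}" "SR \<inter> S2 = {m}"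
      "{u1, u2} \<notin> FR" "{u3, u4} \<notin> FR"
  shows "f ` (insert {u1, u2} (insert {u3, u4} (G1 \<union> G2 \<union> G3)) \<union> FP) =
         f ` (insert {u1, u2} (insert {u3, u4} (G1 \<union> G2 \<union> G3)) \<union> FQ)"
proof -
  note c' = c[unfolded chain_def]
  have c1: "gpath E a S1 G1 u1" and c2: "gpath E u2 S2 G2 u3" and c3: "gpath E u4 S3 G3 b" using c' by auto
  have "m \<in> S2" using R(6) by blast
  have ab: "a \<in> S1" "b \<in> S3" using gpath_start[OF c1] gpath_end[OF c3] by auto
  then have nx: "a \<noteq> x" "b \<noteq> x" using R by auto
  obtain A1 B1 A2 B2 where A: "gpath E a A1 B1 x" "gpath E x A2 B2 b" "SP = A1 \<union> A2" "A1 \<inter> A2 = {x}" "FP = B1 \<union> B2"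
    using gpath_split[OF p(1) R(2)] by metis
  obtain A3 B3 A4 B4 where B: "gpath E u2 A3 B3 m" "gpath E m A4 B4 u3" "S2 = A3 \<union> A4" "A3 \<inter> A4 = {m}" "G2 = B3 \<union> B4"
    using gpath_split[OF c2 \<open>m \<in> S2\<close>] by metis
  have mA: "a \<in> A1" "x \<in> A1" "x \<in> A2" "b \<in> A2" using gpath_start[OF A(1)] gpath_end[OF A(1)] gpath_start[OF A(2)] gpath_end[OF A(2)] by auto
  then have nA: "b \<notin> A1" "a \<notin> A2" using A(4) nx by auto
  have ab2: "a \<notin> S2" "a \<notin> S3" "b \<notin> S1" "b \<notin> S2" using ab c' by auto
  have A1P: "A1 \<subseteq> SP" and A2P: "A2 \<subseteq> SP" using A(3) by auto
  have A1i: "A1 \<inter> (S1 \<union> S2 \<union> S3) = {a}" by (rule inter_part(1)[OF d(1) A1P mA(1) nA(1)])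
  have A2i: "A2 \<inter> (S1 \<union> S2 \<union> S3) = {b}" by (rule inter_part(2)[OF d(1) A2P nA(2) mA(4)])
  have xn: "x \<notin> S2" using A1i mA nx by auto
  have A1Q: "A1 \<inter> SQ = {a}" by (rule inter_part(1)[OF d(3) A1P mA(1) nA(1)])
  have x1: "gpath E x {x} {} x" by (rule gpath_refl)
  have i0: "A1 \<inter> S1 = {a}" using A1i ab by blast
  have x2: "gpath E x (A1 \<union> S1) (B1 \<union> G1) u1" by (rule gpath_append[OF gpath_rev[OF A(1)] c1 i0])
  have a1: "gpath E a {a} {} a" by (rule gpath_refl)
  have xm: "x \<in> SR" "m \<in> SR" using gpath_start[OF R(1)] gpath_end[OF R(1)] by auto
  have xQ: "x \<notin> SQ" using d(3) R(2) nx by auto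
  have el: "A1 \<inter> S1 = {a}" "A1 \<inter> S2 = {}" "A1 \<inter> S3 = {}" "A2 \<inter> S1 = {}" "A2 \<inter> S2 = {}" "A2 \<inter> S3 = {b}"
    "SR \<inter> S1 = {}" "SR \<inter> S3 = {}" "SR \<inter> SQ = {}" "SR \<inter> A1 = {x}" "SR \<inter> A2 = {x}"
  proof -
    have subA1: "A1 \<inter> Y \<subseteq> {a}" if "Y \<subseteq> S1 \<union> S2 \<union> S3" for Y using A1i that by blast
    have "A1 \<inter> S1 \<subseteq> {a}" "A1 \<inter> S2 \<subseteq> {a}" "A1 \<inter> S3 \<subseteq> {a}" by (rule subA1, blast)+
    then show "A1 \<inter> S1 = {a}" "A1 \<inter> S2 = {}" "A1 \<inter> S3 = {}" using mA ab ab2 by blast+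
    have subA2: "A2 \<inter> Y \<subseteq> {b}" if "Y \<subseteq> S1 \<union> S2 \<union> S3" for Y using A2i that by blast
    have "A2 \<inter> S1 \<subseteq> {b}" "A2 \<inter> S2 \<subseteq> {b}" "A2 \<inter> S3 \<subseteq> {b}" by (rule subA2, blast)+
    then show "A2 \<inter> S1 = {}" "A2 \<inter> S2 = {}" "A2 \<inter> S3 = {b}" using mA ab ab2 by blast+
    have subSR: "SR \<inter> Y \<subseteq> {x}" if "Y \<subseteq> S1 \<union> S3 \<union> SP \<union> SQ" for Y using R(5) that by blast
    have *: "SR \<inter> S1 \<subseteq> {x}" "SR \<inter> S3 \<subseteq> {x}" "SR \<inter> SQ \<subseteq> {x}" "SR \<inter> SP \<subseteq> {x}" by (rule subSR, blast)+
    then show "SR \<inter> S1 = {}" "SR \<inter> S3 = {}" "SR \<inter> SQ = {}" using R(3,4) xQ by blast+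
    show "SR \<inter> A1 = {x}" "SR \<inter> A2 = {x}" using *(4) A1P A2P mA xm by blast+
  qed
  then have i1: "A1 \<inter> SR = {x}" by auto
  have ar: "gpath E a (A1 \<union> SR) (B1 \<union> FR) m" by (rule gpath_append[OF A(1) R(1) i1])
  have eB: "{u1, u2} \<notin> B1" "{u3, u4} \<notin> B1"
  proof -
    have "u2 \<in> S2" "u3 \<in> S2" using gpath_start[OF c2] gpath_end[OF c2] by auto
    then have "u2 \<notin> A1" "u3 \<notin> A1" using el(2) by blast+
    then show "{u1, u2} \<notin> B1" "{u3, u4} \<notin> B1" using gpath_edge_subset[OF A(1)] by blast+
  qed
  have c'': "{u1, u2} \<in> E" "{u3, u4} \<in> E" "{u1, u2} \<noteq> {u3, u4}" "f {u1, u2} = f {u3, u4}"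
    "S1 \<inter> S2 = {}" "S1 \<inter> S3 = {}" "S2 \<inter> S3 = {}" using c' by auto
  have 1: "f ` insert {u1, u2} ((B1 \<union> G1) \<union> B3 \<union> FR) =
      f ` (insert {u1, u2} (insert {u3, u4} ({} \<union> (B1 \<union> G1) \<union> B3 \<union> B4 \<union> G3 \<union> B2)))"
  proof (rule detour_image[OF x1 x2 B(1,2) c3 A(2) R(1) refl refl c''(1-4) R(7,8)])
    show "{x} \<inter> (A1 \<union> S1) = {x}" using mA by blast
    show "A3 \<inter> A4 = {m}" by fact
    show "({x} \<union> (A1 \<union> S1)) \<inter> (A3 \<union> A4) = {}" unfolding B(3)[symmetric] using xn el(2) c''(5) by blast
    show "({x} \<union> (A1 \<union> S1)) \<inter> S3 = {}" using R(4) el(3) c''(6) by blast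
    show "(A3 \<union> A4) \<inter> S3 = {}" unfolding B(3)[symmetric] by fact
    have "{x} \<union> (A1 \<union> S1) \<union> A3 \<union> A4 \<union> S3 = {x} \<union> (A1 \<union> S1) \<union> S2 \<union> S3" unfolding B(3) by blast
    moreover have "A2 \<inter> A1 = {x}" "A2 \<inter> {x} = {x}" using A(4) by blast+
    ultimately show "A2 \<inter> ({x} \<union> (A1 \<union> S1) \<union> A3 \<union> A4 \<union> S3) = {x, b}"
      by (simp only: Int_Un_distrib el) blast
    have "{x} \<union> (A1 \<union> S1) \<union> A3 \<union> A4 \<union> S3 \<union> A2 = {x} \<union> (A1 \<union> S1) \<union> S2 \<union> S3 \<union> A2" unfolding B(3) by blast
    moreover have "SR \<inter> {x} = {x}" using xm by blast
    ultimately show "SR \<inter> ({x} \<union> (A1 \<union> S1) \<union> A3 \<union> A4 \<union> S3 \<union> A2) = {x, m}"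
      by (simp only: Int_Un_distrib el R(6)) blast
  qed
  have 2: "f ` insert {u1, u2} (G1 \<union> B3 \<union> (B1 \<union> FR)) =
      f ` (insert {u1, u2} (insert {u3, u4} ({} \<union> G1 \<union> B3 \<union> B4 \<union> G3 \<union> FQ)))"
  proof (rule detour_image[OF a1 c1 B(1,2) c3 p(2) ar refl refl c''(1-4)])
    show "{u1, u2} \<notin> B1 \<union> FR" "{u3, u4} \<notin> B1 \<union> FR" using eB R(7,8) by auto
    show "{a} \<inter> S1 = {a}" using ab by blast
    show "A3 \<inter> A4 = {m}" by fact
    show "({a} \<union> S1) \<inter> (A3 \<union> A4) = {}" unfolding B(3)[symmetric] using c''(5) ab by blast
    show "({a} \<union> S1) \<inter> S3 = {}" using c''(6) ab by blast
    show "(A3 \<union> A4) \<inter> S3 = {}" unfolding B(3)[symmetric] by fact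
    have *: "{a} \<union> S1 \<union> A3 \<union> A4 \<union> S3 = S1 \<union> S2 \<union> S3" unfolding B(3) using ab by blast
    show "SQ \<inter> ({a} \<union> S1 \<union> A3 \<union> A4 \<union> S3) = {a, b}" unfolding * by fact
    show "(A1 \<union> SR) \<inter> ({a} \<union> S1 \<union> A3 \<union> A4 \<union> S3 \<union> SQ) = {a, m}"
      unfolding * by (simp only: Int_Un_distrib Int_Un_distrib2 el R(6) A1Q) blast
  qed
  have "insert {u1, u2} ((B1 \<union> G1) \<union> B3 \<union> FR) = insert {u1, u2} (G1 \<union> B3 \<union> (B1 \<union> FR))" by blast
  then have "f ` (insert {u1, u2} (insert {u3, u4} ({} \<union> (B1 \<union> G1) \<union> B3 \<union> B4 \<union> G3 \<union> B2))) =
     f ` (insert {u1, u2} (insert {u3, u4} ({} \<union> G1 \<union> B3 \<union> B4 \<union> G3 \<union> FQ)))"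
    using 1 2 by simp
  moreover have eq1: "insert {u1, u2} (insert {u3, u4} ({} \<union> (B1 \<union> G1) \<union> B3 \<union> B4 \<union> G3 \<union> B2)) =
     insert {u1, u2} (insert {u3, u4} (G1 \<union> G2 \<union> G3)) \<union> FP" unfolding A(5) B(5) by blast
  moreover have eq2: "insert {u1, u2} (insert {u3, u4} ({} \<union> G1 \<union> B3 \<union> B4 \<union> G3 \<union> FQ)) =
     insert {u1, u2} (insert {u3, u4} (G1 \<union> G2 \<union> G3)) \<union> FQ" unfolding B(5) by blast
  ultimately show ?thesis by (simp only: eq1 eq2)
qed

text \<open>The piece \<open>S2\<close> between the two edges stays connected to the rest when both
  edges are deleted. A connecting path is shortened at both ends, to its first vertex
  \<open>x\<close> outside \<open>S2\<close> on the theta graph and back to the last vertex on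
  \<open>S2\<close> before it. The position of \<open>x\<close> decides which detour lemma applies;
  \<open>S3\<close> reduces to \<open>S1\<close> by reversing the chain, and \<open>SQ\<close> to
  \<open>SP\<close> by exchanging them.\<close>

lemma chain_image:
  assumes c: "chain a S1 G1 u1 u2 S2 G2 u3 u4 S3 G3 b"
    and p: "gpath E a SP FP b" "gpath E a SQ FQ b"
    and d: "SP \<inter> (S1 \<union> S2 \<union> S3) = {a, b}" "SQ \<inter> (S1 \<union> S2 \<union> S3) = {a, b}" "SP \<inter> SQ = {a, b}"
  shows "f ` (insert {u1, u2} (insert {u3, u4} (G1 \<union> G2 \<union> G3)) \<union> FP) =
         f ` (insert {u1, u2} (insert {u3, u4} (G1 \<union> G2 \<union> G3)) \<union> FQ)"
proof -
  note c' = c[unfolded chain_def]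
  have c1: "gpath E a S1 G1 u1" and c2: "gpath E u2 S2 G2 u3" and c3: "gpath E u4 S3 G3 b" using c' by auto
  let ?E = "E - {{u1, u2}, {u3, u4}}"
  have "u1 \<in> V" "u2 \<in> V" using c' edge_subset by blast+
  then obtain S0 F0 where 0: "gpath ?E u2 S0 F0 u1" using gpath_avoiding_edges by metis
  have m: "u1 \<in> S1" "u2 \<in> S2" using gpath_end[OF c1] gpath_start[OF c2] by auto
  obtain S' F' x where 1: "gpath ?E u2 S' F' x" "x \<in> S1 \<union> S3 \<union> SP \<union> SQ" "S' \<inter> (S1 \<union> S3 \<union> SP \<union> SQ) = {x}"
    using gpath_first_hit[OF 0, of "S1 \<union> S3 \<union> SP \<union> SQ"] m by (metis UnI1)
  obtain SR FR v where 2: "gpath ?E x SR FR v" "SR \<inter> S2 = {v}" "SR \<subseteq> S'"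
    using gpath_first_hit[OF gpath_rev[OF 1(1)] m(2)] by metis
  have R: "gpath E x SR FR v" by (rule gpath_supergraph[OF 2(1)]) blast
  have Rn: "{u1, u2} \<notin> FR" "{u3, u4} \<notin> FR" using gpath_subset[OF 2(1)] by blast+
  have Ri: "SR \<inter> (S1 \<union> S3 \<union> SP \<union> SQ) = {x}" using 1(2,3) 2(3) gpath_start[OF R] by blast
  then have Ri2: "SR \<inter> (S3 \<union> S1 \<union> SP \<union> SQ) = {x}" "SR \<inter> (S1 \<union> S3 \<union> SQ \<union> SP) = {x}" by blast+
  consider "x \<in> S1" | "x \<in> S3" | "x \<notin> S1" "x \<notin> S3" "x \<in> SP" | "x \<notin> S1" "x \<notin> S3" "x \<in> SQ"
    using 1(2) by blast
  then show ?thesis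
  proof cases
    case 1
    show ?thesis by (rule chain_detour_inner[OF c p d(1,2) R 1 Ri 2(2) Rn])
  next
    case x: 2
    have d': "SP \<inter> (S3 \<union> S2 \<union> S1) = {b, a}" "SQ \<inter> (S3 \<union> S2 \<union> S1) = {b, a}" using d by blast+
    have n: "{u4, u3} \<notin> FR" "{u2, u1} \<notin> FR" using Rn by (simp_all add: insert_commute)
    have *: "insert {u4, u3} (insert {u2, u1} (G3 \<union> G2 \<union> G1)) = insert {u1, u2} (insert {u3, u4} (G1 \<union> G2 \<union> G3))"
      by (auto simp: insert_commute)
    show ?thesis
      using chain_detour_inner[OF chain_rev[OF c] gpath_rev[OF p(1)] gpath_rev[OF p(2)] d' R x Ri2(1) 2(2) n]
      unfolding * .
  next
    case x: 3
    show ?thesis by (rule chain_detour_side[OF c p d R x(3,1,2) Ri 2(2) Rn])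
  next
    case x: 4
    have i: "SQ \<inter> SP = {a, b}" using d(3) by blast
    show ?thesis
      by (rule chain_detour_side[OF c p(2,1) d(2,1) i R x(3,1,2) Ri2(2) 2(2) Rn, symmetric])
  qed
qed

text \<open>Splitting the path at both edges makes it a \<open>chain\<close>; the two cases are the
  two orders in which \<open>e\<close> and \<open>e'\<close> occur on it.\<close>

lemma theta_same_path_image:
  assumes p: "gpath E a S F b" "gpath E a SP FP b" "gpath E a SQ FQ b"
    and d: "S \<inter> SP = {a, b}" "S \<inter> SQ = {a, b}" "SP \<inter> SQ = {a, b}"
    and e: "e \<in> F" "e' \<in> F" "e \<noteq> e'" "f e = f e'"
  shows "f ` (F \<union> FP) = f ` (F \<union> FQ)"
proof -
  have "\<exists>S1 G1 u1 u2 S2 G2 u3 u4 S3 G3. chain a S1 G1 u1 u2 S2 G2 u3 u4 S3 G3 b \<and> S = S1 \<union> S2 \<union> S3 \<and>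
    F = insert {u1, u2} (insert {u3, u4} (G1 \<union> G2 \<union> G3))"
  proof -
    obtain u1 u2 S1 G1 T H where 1: "e = {u1, u2}" "gpath E a S1 G1 u1" "gpath E u2 T H b" "S = S1 \<union> T"
      "S1 \<inter> T = {}" "F = insert e (G1 \<union> H)"
      using gpath_split_edge[OF p(1) e(1)] by metis
    have E: "e \<in> E" "e' \<in> E" using e gpath_subset[OF p(1)] by auto
    consider "e' \<in> H" | "e' \<in> G1" using e 1 by auto
    then show ?thesis
    proof cases
      case x: 1
      obtain u3 u4 S2 G2 S3 G3 where 2: "e' = {u3, u4}" "gpath E u2 S2 G2 u3" "gpath E u4 S3 G3 b" "T = S2 \<union> S3"
        "S2 \<inter> S3 = {}" "H = insert e' (G2 \<union> G3)"
        using gpath_split_edge[OF 1(3) x] by metis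
      have "chain a S1 G1 u1 u2 S2 G2 u3 u4 S3 G3 b" unfolding chain_def using 1 2 e E by auto
      moreover have "F = insert {u1, u2} (insert {u3, u4} (G1 \<union> G2 \<union> G3))" "S = S1 \<union> S2 \<union> S3" using 1 2 by auto
      ultimately show ?thesis by blast
    next
      case x: 2
      obtain u3 u4 S2 G2 S3 G3 where 2: "e' = {u3, u4}" "gpath E a S2 G2 u3" "gpath E u4 S3 G3 u1" "S1 = S2 \<union> S3"
        "S2 \<inter> S3 = {}" "G1 = insert e' (G2 \<union> G3)"
        using gpath_split_edge[OF 1(2) x] by metis
      have "chain a S2 G2 u3 u4 S3 G3 u1 u2 T H b" unfolding chain_def using 1 2 e E by auto
      moreover have "F = insert {u3, u4} (insert {u1, u2} (G2 \<union> G3 \<union> H))" "S = S2 \<union> S3 \<union> T" using 1 2 by auto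
      ultimately show ?thesis by blast
    qed
  qed
  then obtain S1 G1 u1 u2 S2 G2 u3 u4 S3 G3 where c: "chain a S1 G1 u1 u2 S2 G2 u3 u4 S3 G3 b" "S = S1 \<union> S2 \<union> S3"
    "F = insert {u1, u2} (insert {u3, u4} (G1 \<union> G2 \<union> G3))" by metis
  have "SP \<inter> (S1 \<union> S2 \<union> S3) = {a, b}" "SQ \<inter> (S1 \<union> S2 \<union> S3) = {a, b}" using d c(2) by auto
  from chain_image[OF c(1) p(2,3) this d(3)] show ?thesis unfolding c(3) .
qed

lemma image_not_circ: "\<not> circ E' E'"
proof
  assume C': "circ E' E'"
  obtain r where r: "r \<in> V" using card_V by (metis card.empty ex_in_conv not_less_zero)
  have forest: "card {e \<in> E. f e \<noteq> a} < card V" if a: "a \<in> E'" for a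
  proof (rule forest_card[OF finite_V r])
    show "\<exists>x y. e = {x, y} \<and> x \<noteq> y \<and> x \<in> V \<and> y \<in> V" if "e \<in> {e \<in> E. f e \<noteq> a}" for e
      using that edgeE[of e] by blast
    show "\<not> circ {e \<in> E. f e \<noteq> a} C" for C
    proof
      assume C: "circ {e \<in> E. f e \<noteq> a} C"
      \<comment> \<open>The image of \<open>C\<close> is a circuit inside the circuit
        \<open>E'\<close>, hence all of it, although \<open>C\<close> avoids every edge with value
        \<open>a\<close>.\<close>
      then have "circ E' (f ` C)" by (intro circ_image circ_supergraph[OF C]) auto
      then have "f ` C = E'" using circ_not_subset[OF C'] circ_subset by blast
      then show False using circ_subset[OF C] a by blast
    qed
  qed
  \<comment> \<open>Three values suffice: their fibres are disjoint, so adding the three forest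
    bounds gives \<open>2 * card E < 3 * card V\<close>, against \<open>card_E\<close>.\<close>
  obtain T where "T \<subseteq> E'" "card T = 3" "finite T" using circ_card[OF C'] by (metis obtain_subset_with_card_n)
  then obtain a b c where abc: "a \<in> E'" "b \<in> E'" "c \<in> E'" "a \<noteq> b" "a \<noteq> c" "b \<noteq> c"
    by (auto simp: card_3_iff)
  let ?N = "\<lambda>a. {e \<in> E. f e = a}"
  have N: "card {e \<in> E. f e \<noteq> a} + card (?N a) = card E" for a
  proof -
    have "card ({e \<in> E. f e \<noteq> a} \<union> ?N a) = card {e \<in> E. f e \<noteq> a} + card (?N a)"
      by (rule card_Un_disjoint) (use finite_E in \<open>simp, simp, blast\<close>)
    moreover have "{e \<in> E. f e \<noteq> a} \<union> ?N a = E" by blast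
    ultimately show ?thesis by simp
  qed
  have "card (?N a) + card (?N b) + card (?N c) = card (?N a \<union> ?N b \<union> ?N c)"
  proof -
    have "card (?N a \<union> ?N b) = card (?N a) + card (?N b)"
      by (rule card_Un_disjoint) (use abc finite_E in \<open>simp, simp, blast\<close>)
    moreover have "card ((?N a \<union> ?N b) \<union> ?N c) = card (?N a \<union> ?N b) + card (?N c)"
      by (rule card_Un_disjoint) (use abc finite_E in \<open>simp, simp, blast\<close>)
    ultimately show ?thesis by simp
  qed
  also have "\<dots> \<le> card E" by (rule card_mono[OF finite_E]) auto
  finally show False
    using forest[OF abc(1)] forest[OF abc(2)] forest[OF abc(3)] N[of a] N[of b] N[of c] card_E by linarith
qed

theorem inj: "inj_on f E"
proof (rule inj_onI, rule ccontr)
  fix e e' assume e: "e \<in> E" "e' \<in> E" "f e = f e'" "e \<noteq> e'"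
  obtain C where C: "circ E C" "e \<in> C" "e' \<in> C" using circ_through[OF e(1,2,4)] by blast
  have "f ` C \<noteq> E'" using circ_image[OF C(1)] image_not_circ by metis
  moreover have "f ` C \<subseteq> E'" using circ_subset[OF C(1)] image_E by blast
  ultimately obtain g where g: "g \<in> E" "f g \<notin> f ` C" using image_E by blast
  then have "g \<notin> C" by blast
  obtain p q S F where R: "gpath E p S F q" "p \<noteq> q" "S \<inter> \<Union>C = {p, q}" "g \<in> F" "F \<inter> C = {}"
    using ear[OF C(1) g(1) \<open>g \<notin> C\<close>] by metis
  have "p \<in> \<Union>C" "q \<in> \<Union>C" using R(3) by blast+
  then obtain S1 F1 S2 F2 where A: "gpath E p S1 F1 q" "gpath E p S2 F2 q" "S1 \<inter> S2 = {p, q}" "F1 \<inter> F2 = {}"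
    "C = F1 \<union> F2" "\<Union>C = S1 \<union> S2"
    using circ_arcs[OF C(1) _ _ R(2)] by metis
  have "p \<in> S1" "p \<in> S2" "q \<in> S1" "q \<in> S2" using gpath_start gpath_end A(1,2) by metis+
  then have i: "S1 \<inter> S = {p, q}" "S2 \<inter> S = {p, q}" "S2 \<inter> S1 = {p, q}" using R(3) A(3,6) by auto
  have d: "F1 \<inter> F = {}" "F2 \<inter> F = {}" "F2 \<inter> F1 = {}" using R(5) A(4,5) by blast+
  have c: "circ E (F1 \<union> F2)" "circ E (F1 \<union> F)" "circ E (F2 \<union> F)" "circ E (F2 \<union> F1)"
    using circ_two_paths[OF A(1,2) A(3) R(2) A(4)] circ_two_paths[OF A(1) R(1) i(1) R(2) d(1)]
      circ_two_paths[OF A(2) R(1) i(2) R(2) d(2)] by (simp_all add: Un_commute)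
  \<comment> \<open>Whether \<open>e\<close> and \<open>e'\<close> lie on one arc of
    \<open>C\<close> or on different arcs, some circuit through the ear has the same image as
    \<open>C\<close>. But the ear contains \<open>g\<close>, whose value was chosen outside that
    image.\<close>
  have "f ` (F1 \<union> F) = f ` C \<or> f ` (F2 \<union> F) = f ` C"
  proof -
    consider "e \<in> F1" "e' \<in> F1" | "e \<in> F2" "e' \<in> F2" | "e \<in> F1" "e' \<in> F2" | "e' \<in> F1" "e \<in> F2"
      using C A(5) by blast
    then show ?thesis
    proof cases
      case 1
      show ?thesis using theta_same_path_image[OF A(1,2) R(1) A(3) i(1,2) 1 e(4,3)] A(5) by simp
    next
      case 2
      show ?thesis using theta_same_path_image[OF A(2,1) R(1) i(3) i(2,1) 2 e(4,3)] A(5) by (simp add: Un_commute)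
    next
      case 3
      show ?thesis using theta_image[OF c(1-3) 3 e(3)] A(5) by simp
    next
      case 4
      show ?thesis using theta_image[OF c(1-3) 4 e(3)[symmetric]] A(5) by simp
    qed
  qed
  then show False using g(2) R(4) by blast
qed

end

section \<open>Cuts met at most twice by every circuit\<close>
context three_connected_graph
begin

text \<open>This is what a star of \<open>G'\<close> leaves behind when pulled back: a circuit has
  at most two edges at any vertex.\<close>

definition narrow :: "'a set \<Rightarrow> bool" where
  "narrow X \<longleftrightarrow> X \<subseteq> V \<and> (\<forall>C. circ E C \<longrightarrow> card (C \<inter> cut E X) \<le> 2)"

lemma cut_compl: "cut E (V - X) = cut E X"
  by (rule cut_complement) (rule edge_subset)

lemma narrow_compl: "narrow X \<Longrightarrow> narrow (V - X)"
  unfolding narrow_def cut_compl by auto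

text \<open>A circuit through \<open>u\<close> and \<open>v\<close> avoiding \<open>c\<close> crosses the cut at most twice, and each of its two arcs
  crosses it an even number of times, so one arc stays inside \<open>X\<close>.\<close>
lemma narrow_connected:
  assumes X: "narrow X" and u: "u \<in> X - {c}" and v: "v \<in> X - {c}"
  shows "\<exists>S F. gpath E u S F v \<and> S \<subseteq> X - {c}"
proof (cases "u = v")
  case True
  then show ?thesis using gpath_refl[of E u] u by blast
next
  case False
  have "u \<in> V - {c}" "v \<in> V - {c}" using X u v unfolding narrow_def by auto
  then obtain S F where p: "gpath E u S F v" "S \<inter> {c} = {}" using gpath_avoiding[of "{c}" u v] by auto
  obtain e1 where e1: "e1 \<in> F" "u \<in> e1" using gpath_start_degree[OF p(1) False] by blast
  obtain e2 where e2: "e2 \<in> F" "v \<in> e2" using gpath_start_degree[OF gpath_rev[OF p(1)]] False by blast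
  have e: "e1 \<in> E" "e2 \<in> E" "c \<notin> e1" "c \<notin> e2"
    using e1 e2 gpath_subset[OF p(1)] gpath_edge_subset[OF p(1)] p(2) by blast+
  show ?thesis
  proof (cases "e1 = e2")
    case True
    then obtain x y where "e1 = {x, y}" "x \<noteq> y" using e edgeE by metis
    then have "e1 = {u, v}" using e1 e2 True False by auto
    then show ?thesis using gpath_single[of u v E] e False u v by blast
  next
    case e12: False
    obtain C where C: "circ E C" "e1 \<in> C" "e2 \<in> C" "c \<notin> \<Union>C"
      using circ_through_edges_avoiding[OF e(1,2) e12 e(3,4)] by blast
    have "u \<in> \<Union>C" "v \<in> \<Union>C" using C e1 e2 by blast+
    then obtain P G Q H where a: "gpath E u P G v" "gpath E u Q H v" "G \<inter> H = {}" "C = G \<union> H" "\<Union>C = P \<union> Q"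
      using circ_arcs[OF C(1) _ _ False] by metis
    have uv: "u \<in> X" "v \<in> X" using u v by auto
    have ev: "even (card (G \<inter> cut E X))" "even (card (H \<inter> cut E X))"
      using gpath_cut_parity[OF a(1) order_refl, of X] gpath_cut_parity[OF a(2) order_refl, of X] uv by auto
    have fin: "finite G" "finite H" using gpath_finite_edges[OF a(1)] gpath_finite_edges[OF a(2)] by auto
    have "C \<inter> cut E X = (G \<inter> cut E X) \<union> (H \<inter> cut E X)" using a(4) by blast
    then have "card (C \<inter> cut E X) = card (G \<inter> cut E X) + card (H \<inter> cut E X)"
      using a(3) fin by (simp add: card_Un_disjoint disjoint_iff)
    moreover have "card (C \<inter> cut E X) \<le> 2" using X C(1) unfolding narrow_def by blast
    ultimately have "card (G \<inter> cut E X) = 0 \<or> card (H \<inter> cut E X) = 0" using ev by presburger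
    then have "G \<inter> cut E X = {} \<or> H \<inter> cut E X = {}" using fin by simp
    then have "P \<subseteq> X \<or> Q \<subseteq> X" using gpath_within[OF a(1) _ uv(1)] gpath_within[OF a(2) _ uv(1)] by metis
    moreover have "c \<notin> P" "c \<notin> Q" using C(4) unfolding a(5) by auto
    ultimately have "P \<subseteq> X - {c} \<or> Q \<subseteq> X - {c}" by blast
    then show ?thesis
    proof
      assume "P \<subseteq> X - {c}" then show ?thesis using a(1) by (intro exI conjI)
    next
      assume "Q \<subseteq> X - {c}" then show ?thesis using a(2) by (intro exI conjI)
    qed
  qed
qed

text \<open>By \<open>narrow_connected\<close> the subgraph induced by \<open>X\<close> remains
  connected after deletion of any vertex, so \<open>menger2\<close> works inside \<open>X\<close>.
  The pairing of the ends cannot be prescribed, which accounts for the disjunction.\<close>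

lemma narrow_linkage:
  assumes X: "narrow X" and ab: "{a, b, c, d} \<subseteq> X" "a \<noteq> b" "c \<noteq> d"
  shows "\<exists>S F T G. S \<subseteq> X \<and> T \<subseteq> X \<and> S \<inter> T = {} \<and>
    (gpath E a S F c \<and> gpath E b T G d \<or> gpath E a S F d \<and> gpath E b T G c)"
proof -
  let ?E = "{e \<in> E. e \<subseteq> X}"
  have tp: "two_paths ?E {a, b} {c, d}"
  proof (rule menger2)
    show "finite ?E" using finite_E by simp
    show "\<exists>x y. e = {x, y}" if "e \<in> ?E" for e using that pair by blast
    fix z
    obtain u where u: "u \<in> {a, b}" "u \<noteq> z" using two_vertices_avoid[OF ab(2)] by blast
    obtain w where w: "w \<in> {c, d}" "w \<noteq> z" using two_vertices_avoid[OF ab(3)] by blast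
    have "u \<in> X - {z}" "w \<in> X - {z}" using u w ab by auto
    then obtain S F where p: "gpath E u S F w" "S \<subseteq> X - {z}" using narrow_connected[OF X] by metis
    have "F \<subseteq> ?E" using gpath_subset[OF p(1)] gpath_edge_subset[OF p(1)] p(2) by blast
    then have "gpath ?E u S F w" by (rule gpath_mono[OF p(1)])
    moreover have "z \<notin> S" using p by blast
    ultimately show "\<exists>a\<in>{a, b}. \<exists>b\<in>{c, d}. \<exists>S F. gpath ?E a S F b \<and> z \<notin> S" using u w by blast
  qed
  obtain a1 a2 S T F G where p: "a1 \<in> {a, b}" "a2 \<in> {a, b}" "gpath ?E a1 S F c" "gpath ?E a2 T G d" "S \<inter> T = {}"
    by (rule two_paths_pair[OF tp])
  have "a1 \<noteq> a2" using gpath_start[OF p(3)] gpath_start[OF p(4)] p(5) by auto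
  have a: "a1 \<in> X" "a2 \<in> X" using p(1,2) ab(1) by auto
  have "\<Union>F \<subseteq> X" "\<Union>G \<subseteq> X" using gpath_subset[OF p(3)] gpath_subset[OF p(4)] by blast+
  then have s: "S \<subseteq> X" "T \<subseteq> X" using gpath_verts[OF p(3)] gpath_verts[OF p(4)] a by blast+
  have "?E \<subseteq> E" by auto
  then have g: "gpath E a1 S F c" "gpath E a2 T G d" using gpath_supergraph[OF p(3)] gpath_supergraph[OF p(4)] by simp_all
  consider "a1 = a" "a2 = b" | "a1 = b" "a2 = a" using p(1,2) \<open>a1 \<noteq> a2\<close> by auto
  then show ?thesis
  proof cases
    case 1
    show ?thesis by (rule exI[of _ S], rule exI[of _ F], rule exI[of _ T], rule exI[of _ G])
        (use s g p(5) 1 in simp)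
  next
    case 2
    show ?thesis by (rule exI[of _ T], rule exI[of _ G], rule exI[of _ S], rule exI[of _ F])
        (use s g p(5) 2 in \<open>simp add: Int_commute\<close>)
  qed
qed

text \<open>The circuit runs through \<open>x1\<close>, \<open>x3\<close>, \<open>y3\<close>,
  \<open>y4\<close>, \<open>x4\<close>, \<open>x2\<close>, \<open>y2\<close>, \<open>y1\<close> and
  back to \<open>x1\<close>, crossing the cut four times. The paths may be trivial; in particular
  \<open>x1 = x3\<close> is allowed, and the crossing edges are then told apart by their ends
  outside \<open>X\<close>.\<close>

lemma narrow_no_four_crossings_aux:
  assumes X: "narrow X"
    and p: "gpath E x1 S1 F1 x3" "gpath E x2 S2 F2 x4" "S1 \<subseteq> X" "S2 \<subseteq> X" "S1 \<inter> S2 = {}"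
    and q: "gpath E y1 T1 G1 y2" "gpath E y3 T2 G2 y4" "T1 \<subseteq> V - X" "T2 \<subseteq> V - X" "T1 \<inter> T2 = {}"
    and e: "{x1, y1} \<in> E" "{x2, y2} \<in> E" "{x3, y3} \<in> E" "{x4, y4} \<in> E"
    and ne: "y1 \<noteq> y3" "y2 \<noteq> y4"
  shows False
proof -
  have m: "x1 \<in> S1" "x3 \<in> S1" "x2 \<in> S2" "x4 \<in> S2" "y1 \<in> T1" "y2 \<in> T1" "y3 \<in> T2" "y4 \<in> T2"
    using p q gpath_start gpath_end by metis+
  have d: "S \<inter> T = {}" if "S \<subseteq> X" "T \<subseteq> V - X" for S T using that by blast
  have "gpath E x1 (S1 \<union> T2) (insert {x3, y3} (F1 \<union> G2)) y4"
    by (rule gpath_join_edge[OF p(1) q(2) e(3) d[OF p(3) q(4)]])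
  moreover have "(S1 \<union> T2) \<inter> S2 = {}" using d[OF p(4) q(4)] p(5) by blast
  moreover have "{y4, x4} \<in> E" using e(4) by (simp add: insert_commute)
  ultimately have "gpath E x1 (S1 \<union> T2 \<union> S2) (insert {y4, x4} (insert {x3, y3} (F1 \<union> G2) \<union> F2)) x2"
    using gpath_join_edge gpath_rev[OF p(2)] by metis
  moreover have "(S1 \<union> T2 \<union> S2) \<inter> T1 = {}" using d[OF p(3) q(3)] d[OF p(4) q(3)] q(5) by blast
  ultimately have 1: "gpath E x1 (S1 \<union> T2 \<union> S2 \<union> T1)
      (insert {x2, y2} (insert {y4, x4} (insert {x3, y3} (F1 \<union> G2) \<union> F2) \<union> G1)) y1" (is "gpath E x1 ?S ?F y1")
    using gpath_join_edge gpath_rev[OF q(1)] e(2) by metis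
  have XY: "x1 \<in> X" "x2 \<in> X" "x3 \<in> X" "x4 \<in> X" "y1 \<notin> X" "y2 \<notin> X" "y3 \<notin> X" "y4 \<notin> X"
    using m p(3,4) q(3,4) by blast+
  have "x1 \<noteq> y1" "x1 \<noteq> y3" using XY by auto
  then have "3 \<le> card ?S" by (intro card_ge_3[OF gpath_finite[OF 1], of x1 y1 y3]) (use m ne in auto)
  then have C: "circ E (insert {x1, y1} ?F)" unfolding circ_def using 1 e(1) by blast
  have x: "x1 \<noteq> x2" "x1 \<noteq> x4" "x3 \<noteq> x2" "x3 \<noteq> x4" using m p(5) by auto
  let ?T = "{{x1, y1}, {x2, y2}, {x3, y3}, {x4, y4}}"
  have "?T \<subseteq> insert {x1, y1} ?F \<inter> cut E X" using e XY by (auto simp: insert_commute)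
  then have "card ?T \<le> card (insert {x1, y1} ?F \<inter> cut E X)"
    by (rule card_mono[rotated]) (use circ_finite[OF C] in blast)
  moreover have "card (insert {x1, y1} ?F \<inter> cut E X) \<le> 2" using X C unfolding narrow_def by blast
  moreover have "card ?T = 4" using x ne XY by (auto simp: doubleton_eq_iff card_insert_if)
  ultimately show False by simp
qed

text \<open>Inside \<open>X\<close> the crossings are paired as 1 with 3 and 2 with 4. Outside, a
  linkage from \<open>{y1, y3}\<close> to \<open>{y2, y4}\<close> is requested, so whichever pairing
  it yields, the pieces close up to one circuit and never to two.\<close>

lemma narrow_no_four_crossings:
  assumes X: "narrow X"
    and p: "gpath E x1 S1 F1 x3" "gpath E x2 S2 F2 x4" "S1 \<subseteq> X" "S2 \<subseteq> X" "S1 \<inter> S2 = {}"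
    and y: "{y1, y2, y3, y4} \<subseteq> V - X"
    and e: "{x1, y1} \<in> E" "{x2, y2} \<in> E" "{x3, y3} \<in> E" "{x4, y4} \<in> E"
    and ne: "y1 \<noteq> y3" "y2 \<noteq> y4"
  shows False
proof -
  have "{y1, y3, y2, y4} \<subseteq> V - X" using y by blast
  from narrow_linkage[OF narrow_compl[OF X] this ne]
  obtain S F T G where s: "S \<subseteq> V - X" "T \<subseteq> V - X" "S \<inter> T = {}"
    and "gpath E y1 S F y2 \<and> gpath E y3 T G y4 \<or> gpath E y1 S F y4 \<and> gpath E y3 T G y2" by metis
  then consider "gpath E y1 S F y2" "gpath E y3 T G y4" | "gpath E y1 S F y4" "gpath E y3 T G y2" by blast
  then show False
  proof cases
    case 1
    show False by (rule narrow_no_four_crossings_aux[OF X p 1 s e ne])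
  next
    case 2
    show False
      by (rule narrow_no_four_crossings_aux[OF X p(1) gpath_rev[OF p(2)] p(3-5) 2 s e(1,4,3,2) ne(1) ne(2)[symmetric]])
  qed
qed

text \<open>Two cut edges at \<open>x\<close> count as two crossings joined by the trivial path at
  \<open>x\<close>. Two more cut edges away from \<open>x\<close> are joined inside
  \<open>X - {x}\<close>, which gives four crossings.\<close>

lemma narrow_matching:
  assumes X: "narrow X" and x: "x \<in> X" "X \<noteq> {x}" and y: "y1 \<in> V - X" "y2 \<in> V - X"
    and e: "{x, y1} \<in> E" "{x, y2} \<in> E"
  shows "y1 = y2"
proof (rule ccontr)
  assume ne: "y1 \<noteq> y2"
  have XV: "X \<subseteq> V" "X \<noteq> {}" "X \<noteq> V" using X x y unfolding narrow_def by auto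
  obtain p where p: "p \<in> X" "p \<noteq> x" using x by blast
  \<comment> \<open>Avoiding \<open>y1\<close> keeps \<open>y1\<close> available, outside
    \<open>{x, y3}\<close>, for the second application; avoiding \<open>y3\<close> there makes the
    outer ends of the two new edges distinct.\<close>
  have "p \<in> X - {x, y1}" "y2 \<in> V - X - {x, y1}" using p x y ne by auto
  from cut_nonempty[OF XV _ card_pair_le this]
  obtain x3 y3 where 3: "{x3, y3} \<in> cut E X" "x3 \<in> X - {x, y1}" "y3 \<in> V - X - {x, y1}" by auto
  have "p \<in> X - {x, y3}" "y1 \<in> V - X - {x, y3}" using p x y 3 by auto
  from cut_nonempty[OF XV _ card_pair_le this]
  obtain x4 y4 where 4: "{x4, y4} \<in> cut E X" "x4 \<in> X - {x, y3}" "y4 \<in> V - X - {x, y3}" by auto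
  have "x3 \<in> X - {x}" "x4 \<in> X - {x}" using 3 4 by auto
  then obtain S F where S: "gpath E x3 S F x4" "S \<subseteq> X - {x}" using narrow_connected[OF X] by metis
  show False
  proof (rule narrow_no_four_crossings[OF X gpath_refl[of E x] S(1)])
    show "{x, y1} \<in> E" "{x, y2} \<in> E" by fact+
    show "{x3, y3} \<in> E" "{x4, y4} \<in> E" using 3 4 cut_subset by blast+
    show "y1 \<noteq> y2" "y3 \<noteq> y4" using ne 4 by auto
    show "{y1, y3, y2, y4} \<subseteq> V - X" using y 3 4 by auto
  qed (use S x in auto)
qed

text \<open>With no side a single vertex, \<open>narrow_matching\<close> for \<open>X\<close> and
  for \<open>V - X\<close> makes the cut a matching. Any four of its edges therefore have distinct
  ends, so a linkage inside \<open>X\<close> produces four crossings.\<close>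

lemma narrow_card:
  assumes X: "narrow X" and card: "card X \<noteq> 1" "card (V - X) \<noteq> 1"
  shows "card (cut E X) \<le> 3"
proof (rule ccontr)
  assume "\<not> card (cut E X) \<le> 3"
  then have "4 \<le> card (cut E X)" by simp
  then obtain T where T: "T \<subseteq> cut E X" "card T = 4" by (metis obtain_subset_with_card_n)
  then obtain e1 T1 where "T = insert e1 T1" "e1 \<notin> T1" "card T1 = 3"
    using card_eq_SucD[of T 3] by auto
  then obtain e2 e3 e4 where T4: "T = {e1, e2, e3, e4}" and d: "e1 \<noteq> e2" "e1 \<noteq> e3" "e1 \<noteq> e4" "e2 \<noteq> e3" "e2 \<noteq> e4" "e3 \<noteq> e4"
    by (auto simp: card_3_iff)
  have c: "e1 \<in> cut E X" "e2 \<in> cut E X" "e3 \<in> cut E X" "e4 \<in> cut E X" using T T4 by auto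
  obtain x1 y1 where 1: "e1 = {x1, y1}" "x1 \<in> V \<inter> X" "y1 \<in> V - X" using c(1) by (rule cut_edgeE)
  obtain x2 y2 where 2: "e2 = {x2, y2}" "x2 \<in> V \<inter> X" "y2 \<in> V - X" using c(2) by (rule cut_edgeE)
  obtain x3 y3 where 3: "e3 = {x3, y3}" "x3 \<in> V \<inter> X" "y3 \<in> V - X" using c(3) by (rule cut_edgeE)
  obtain x4 y4 where 4: "e4 = {x4, y4}" "x4 \<in> V \<inter> X" "y4 \<in> V - X" using c(4) by (rule cut_edgeE)
  have E: "{x1, y1} \<in> E" "{x2, y2} \<in> E" "{x3, y3} \<in> E" "{x4, y4} \<in> E" using c cut_subset 1 2 3 4 by blast+
  have mx: "x \<noteq> x'" if "x \<in> V \<inter> X" "x' \<in> V \<inter> X" "y \<in> V - X" "y' \<in> V - X" "{x, y} \<in> E" "{x', y'} \<in> E" "{x, y} \<noteq> {x', y'}" for x x' y y'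
    using narrow_matching[OF X, of x y y'] that card(1) by (metis Int_iff is_singletonI is_singleton_altdef)
  have my: "y \<noteq> y'" if "x \<in> V \<inter> X" "x' \<in> V \<inter> X" "y \<in> V - X" "y' \<in> V - X" "{x, y} \<in> E" "{x', y'} \<in> E" "{x, y} \<noteq> {x', y'}" for x x' y y'
    using narrow_matching[OF narrow_compl[OF X], of y x x'] that card(2)
    by (metis Diff_iff Int_iff insert_commute is_singletonI is_singleton_altdef)
  have x12: "x1 \<noteq> x2" and x34: "x3 \<noteq> x4" using mx 1 2 3 4 E d by metis+
  have y: "y1 \<noteq> y3" "y2 \<noteq> y4" "y1 \<noteq> y4" "y2 \<noteq> y3" using my 1 2 3 4 E d by metis+
  have "{x1, x2, x3, x4} \<subseteq> X" using 1 2 3 4 by auto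
  from narrow_linkage[OF X this x12 x34]
  obtain S F T G where s: "S \<subseteq> X" "T \<subseteq> X" "S \<inter> T = {}"
    and "gpath E x1 S F x3 \<and> gpath E x2 T G x4 \<or> gpath E x1 S F x4 \<and> gpath E x2 T G x3" by metis
  then consider "gpath E x1 S F x3" "gpath E x2 T G x4" | "gpath E x1 S F x4" "gpath E x2 T G x3" by blast
  moreover have "{y1, y2, y3, y4} \<subseteq> V - X" "{y1, y2, y4, y3} \<subseteq> V - X" using 1 2 3 4 by auto
  ultimately show False
    using narrow_no_four_crossings[OF X _ _ s] E y by metis
qed

end

section \<open>Stars\<close>
context circuit_map
begin

lemma edge'E:
  assumes "e \<in> E'"
  obtains x y where "e = {x, y}" "x \<noteq> y" "x \<in> V'" "y \<in> V'"
  using assms simple' unfolding simple_graph_def by meson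

lemma finite_E': "finite E'"
  using finite_E image_E by auto

lemma edge'_subset: "e \<in> E' \<Longrightarrow> e \<subseteq> V'"
  by (elim edge'E) simp

lemma V'_eq: "V' = \<Union>E'"
  using no_isolated edge'_subset unfolding no_isolated_vertices_def by blast

lemma finite_V': "finite V'"
  unfolding V'_eq using finite_E' by (auto elim: edge'E)

lemma f_edge: "e \<in> E \<Longrightarrow> f e \<in> E'"
  using image_E by blast

definition star_preimage :: "'b \<Rightarrow> 'a set set" where
  "star_preimage w = {e \<in> E. w \<in> f e}"

lemma card_image_circ:
  assumes "circ E C"
  shows "card {e \<in> C. P (f e)} = card {e \<in> f ` C. P e}"
proof -
  have "{e \<in> f ` C. P e} = f ` {e \<in> C. P (f e)}" by blast
  moreover have "inj_on f {e \<in> C. P (f e)}"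
    by (rule inj_on_subset[OF inj]) (use circ_subset[OF assms] in blast)
  ultimately show ?thesis by (simp add: card_image)
qed

text \<open>Since \<open>f\<close> is injective, a circuit meets the preimage in as many edges as
  its image meets the cut of \<open>G'\<close>, an even number; \<open>even_imp_cut\<close> does the
  rest.\<close>

lemma cut_preimage: "\<exists>X. {e \<in> E. f e \<in> cut E' Y} = cut E X"
proof (rule even_imp_cut[OF finite_E pair])
  fix C assume C: "circ E C"
  have "C \<inter> {e \<in> E. f e \<in> cut E' Y} = {e \<in> C. f e \<in> cut E' Y}" using circ_subset[OF C] by blast
  then have "card (C \<inter> {e \<in> E. f e \<in> cut E' Y}) = card {e \<in> f ` C. e \<in> cut E' Y}"
    using card_image_circ[OF C] by simp
  also have "{e \<in> f ` C. e \<in> cut E' Y} = f ` C \<inter> cut E' Y" by blast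
  finally show "even (card (C \<inter> {e \<in> E. f e \<in> cut E' Y}))" using circ_cut_even[OF circ_image[OF C]] by simp
qed auto

text \<open>Fixing a vertex that the side must miss picks one of the two sides, so that the later
  count of cuts runs over subsets of \<open>V - {r}\<close>.\<close>

lemma cut_preimage_avoiding: "\<exists>X. X \<subseteq> V - {r} \<and> {e \<in> E. f e \<in> cut E' Y} = cut E X"
proof -
  obtain X where X: "{e \<in> E. f e \<in> cut E' Y} = cut E X" using cut_preimage by blast
  have 1: "cut E X = cut E (V \<inter> X)" using edge_subset unfolding cut_def by blast
  show ?thesis
  proof (cases "r \<in> X")
    case True
    then have "V - X \<subseteq> V - {r}" by blast
    then show ?thesis using X cut_compl by metis
  next
    case False
    then have "V \<inter> X \<subseteq> V - {r}" by blast
    then show ?thesis using X 1 by metis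
  qed
qed

lemma star_preimage_eq: "star_preimage w = {e \<in> E. f e \<in> cut E' {w}}"
proof -
  have "cut E' {w} = {e \<in> E'. w \<in> e}" by (rule cut_eq_star) (use edge'E in metis)
  then show ?thesis using f_edge unfolding star_preimage_def by auto
qed

lemma star_preimage_circ_le: "circ E C \<Longrightarrow> card (C \<inter> star_preimage w) \<le> 2"
proof -
  assume C: "circ E C"
  have "C \<inter> star_preimage w = {e \<in> C. w \<in> f e}" using circ_subset[OF C] unfolding star_preimage_def by blast
  then show ?thesis using card_image_circ[OF C, of "\<lambda>e. w \<in> e"] circ_degree_le[OF circ_image[OF C], of w] by simp
qed

lemma star_preimage_circ_even: "circ E C \<Longrightarrow> even (card (C \<inter> star_preimage w))"
proof -
  assume C: "circ E C"
  have "C \<inter> star_preimage w = {e \<in> C. w \<in> f e}" using circ_subset[OF C] unfolding star_preimage_def by blast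
  then show ?thesis using card_image_circ[OF C, of "\<lambda>e. w \<in> e"] circ_degree_even[OF circ_image[OF C], of w] by simp
qed

lemma star_preimage_nonempty:
  assumes "w \<in> V'"
  shows "star_preimage w \<noteq> {}"
proof -
  obtain e' where "e' \<in> E'" "w \<in> e'" using assms V'_eq by blast
  then show ?thesis using image_E unfolding star_preimage_def by blast
qed

lemma star_preimage_cases:
  assumes "w \<in> V'"
  shows "(\<exists>v\<in>V. star_preimage w = {e \<in> E. v \<in> e}) \<or> card (star_preimage w) \<le> 3"
proof -
  \<comment> \<open>Only \<open>X \<subseteq> V\<close> is wanted here, so any value serves as the
    vertex to be missed.\<close>
  obtain X where X: "X \<subseteq> V" "star_preimage w = cut E X"
    using cut_preimage_avoiding[of undefined "{w}"] unfolding star_preimage_eq by blast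
  have "narrow X" unfolding narrow_def using X star_preimage_circ_le by metis
  have star: "\<exists>v\<in>V. cut E Y = {e \<in> E. v \<in> e}" if Y: "card Y = 1" "Y \<subseteq> V" for Y
    using Y cut_singleton by (metis card_1_singletonE insert_subset)
  consider "card X = 1" | "card (V - X) = 1" | "card X \<noteq> 1" "card (V - X) \<noteq> 1" by blast
  then show ?thesis
  proof cases
    case 1 then show ?thesis using star[of X] X by simp
  next
    case 2 then show ?thesis using star[of "V - X"] X cut_compl by auto
  next
    case 3 then show ?thesis using narrow_card[OF \<open>narrow X\<close>] X by simp
  qed
qed

text \<open>Otherwise all edges at \<open>v\<close>, at least three, would be mapped to the one edge
  \<open>{w, w'}\<close>, against injectivity.\<close>

lemma star_preimage_inj:
  assumes "v \<in> V" "star_preimage w = {e \<in> E. v \<in> e}" "star_preimage w' = {e \<in> E. v \<in> e}"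
  shows "w = w'"
proof (rule ccontr)
  assume "w \<noteq> w'"
  have eq: "f e = {w, w'}" if e: "e \<in> E" "v \<in> e" for e
  proof -
    have "w \<in> f e" "w' \<in> f e" using assms(2,3) e unfolding star_preimage_def by blast+
    moreover obtain x y where "f e = {x, y}" using f_edge[OF e(1)] by (elim edge'E)
    ultimately show ?thesis using \<open>w \<noteq> w'\<close> by auto
  qed
  have "inj_on f {e \<in> E. v \<in> e}" by (rule inj_on_subset[OF inj]) auto
  then have "card {e \<in> E. v \<in> e} = card (f ` {e \<in> E. v \<in> e})" by (simp add: card_image)
  also have "\<dots> \<le> card {{w, w'}}" by (rule card_mono) (use eq in auto)
  finally show False using degree[OF assms(1)] by simp
qed

lemma handshake': "(\<Sum>w\<in>V'. card (star_preimage w)) = 2 * card E"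
  unfolding star_preimage_def
proof (rule double_count[OF finite_V' finite_E])
  fix e assume "e \<in> E"
  then have "f e \<in> E'" by (rule f_edge)
  then obtain x y where "f e = {x, y}" "x \<noteq> y" "x \<in> V'" "y \<in> V'" by (rule edge'E)
  moreover from this have "V' \<inter> f e = {x, y}" by auto
  ultimately show "card (V' \<inter> f e) = 2" by simp
qed

text \<open>Both degree sums equal \<open>2 * card E\<close>; the vertices of \<open>G'\<close> whose star does not pull back to a
  star have degree at most 3, whereas every vertex of \<open>G\<close> has degree at least 3.\<close>
lemma card_V_le: "card V \<le> card V'"
proof -
  define S where "S = {w \<in> V'. \<exists>v\<in>V. star_preimage w = {e \<in> E. v \<in> e}}"
  define \<psi> where "\<psi> w = (SOME v. v \<in> V \<and> star_preimage w = {e \<in> E. v \<in> e})" for w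
  let ?d = "\<lambda>v. card {e \<in> E. v \<in> e}"
  have \<psi>: "\<psi> w \<in> V \<and> star_preimage w = {e \<in> E. \<psi> w \<in> e}" if "w \<in> S" for w
    unfolding \<psi>_def by (rule someI_ex) (use that in \<open>auto simp: S_def\<close>)
  have inj\<psi>: "inj_on \<psi> S" by (rule inj_onI) (metis \<psi> star_preimage_inj)
  have SV: "S \<subseteq> V'" unfolding S_def by blast
  have \<psi>V: "\<psi> ` S \<subseteq> V" using \<psi> by blast
  have "(\<Sum>v\<in>\<psi> ` S. ?d v) = (\<Sum>w\<in>S. card (star_preimage w))"
    unfolding sum.reindex[OF inj\<psi>] by (rule sum.cong) (use \<psi> in auto)
  moreover have "(\<Sum>v\<in>V - \<psi> ` S. ?d v) + (\<Sum>v\<in>\<psi> ` S. ?d v) = 2 * card E"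
    using sum.subset_diff[OF \<psi>V finite_V] handshake by metis
  moreover have "(\<Sum>w\<in>V' - S. card (star_preimage w)) + (\<Sum>w\<in>S. card (star_preimage w)) = 2 * card E"
    using sum.subset_diff[OF SV finite_V'] handshake' by metis
  moreover have "(\<Sum>v\<in>V - \<psi> ` S. 3) \<le> (\<Sum>v\<in>V - \<psi> ` S. ?d v)" by (rule sum_mono) (use degree in auto)
  moreover have "(\<Sum>w\<in>V' - S. card (star_preimage w)) \<le> (\<Sum>w\<in>V' - S. 3)"
    by (rule sum_mono) (use star_preimage_cases in \<open>auto simp: S_def\<close>)
  ultimately have "card (V - \<psi> ` S) \<le> card (V' - S)" by simp
  moreover have "card (V - \<psi> ` S) = card V - card S" "card (V' - S) = card V' - card S"
    using card_Diff_subset[OF finite_subset[OF \<psi>V finite_V] \<psi>V] card_Diff_subset[OF finite_subset[OF SV finite_V'] SV]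
      card_image[OF inj\<psi>] by auto
  moreover have "card S \<le> card V'" by (rule card_mono[OF finite_V' SV])
  ultimately show ?thesis by linarith
qed

text \<open>Connectedness of \<open>G'\<close>: any two of its edges coincide or lie in the image of
  a common circuit of \<open>G\<close>, and a circuit that avoids a cut stays on one side.\<close>

lemma image_connected:
  assumes "cut E' K = {}" "u \<in> K" "u \<in> V'" "w \<in> V'"
  shows "w \<in> K"
proof -
  obtain e1 where e1: "e1 \<in> E" "u \<in> f e1" using star_preimage_nonempty[OF assms(3)] unfolding star_preimage_def by blast
  obtain e2 where e2: "e2 \<in> E" "w \<in> f e2" using star_preimage_nonempty[OF assms(4)] unfolding star_preimage_def by blast
  show ?thesis
  proof (cases "e1 = e2")
    case True
    have "f e1 \<notin> cut E' K" using assms(1) by blast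
    then show ?thesis using True e1 e2 f_edge[OF e1(1)] assms(2) unfolding cut_def by blast
  next
    case False
    then obtain C where C: "circ E C" "e1 \<in> C" "e2 \<in> C" using circ_through e1 e2 by metis
    show ?thesis
      by (rule circ_within[OF circ_image[OF C(1)] _ _ _ assms(2)]) (use assms(1) C e1 e2 in auto)
  qed
qed

text \<open>No edge leaves the set of vertices on which \<open>S\<close> and \<open>T\<close> agree,
  and this set contains \<open>r\<close>; connectedness makes it everything.\<close>

lemma cut_image_inj:
  assumes "cut E' S = cut E' T" "S \<subseteq> V' - {r}" "T \<subseteq> V' - {r}" "r \<in> V'"
  shows "S = T"
proof -
  define K where "K = {w. w \<in> S \<longleftrightarrow> w \<in> T}"
  have "cut E' K = {}"
  proof (rule ccontr)
    assume "cut E' K \<noteq> {}"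
    then obtain e where e: "e \<in> cut E' K" by blast
    then have "e \<in> E'" using cut_subset by blast
    then obtain x y where xy: "e = {x, y}" by (elim edge'E)
    have "e \<in> cut E' S \<longleftrightarrow> e \<in> cut E' T" using assms(1) by simp
    then show False using e \<open>e \<in> E'\<close> unfolding xy cut_pair K_def by auto
  qed
  moreover have "r \<in> K" using assms(2,3) unfolding K_def by blast
  ultimately have "V' \<subseteq> K" using image_connected assms(4) by blast
  then show ?thesis using assms(2,3) unfolding K_def by blast
qed

text \<open>Pulling back cuts is injective, and \<open>G'\<close> has at least as many vertices as \<open>G\<close>; hence every
  cut of \<open>G\<close> is the preimage of a cut.\<close>
lemma star_is_cut_preimage:
  assumes v: "v \<in> V"
  shows "\<exists>Y. {e \<in> E. f e \<in> cut E' Y} = {e \<in> E. v \<in> e}"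
proof -
  have "V' \<noteq> {}" using card_V_le card_V by auto
  then obtain r' where r': "r' \<in> V'" by blast
  define \<Phi> where "\<Phi> Y = (SOME X. X \<subseteq> V - {v} \<and> {e \<in> E. f e \<in> cut E' Y} = cut E X)" for Y
  have \<Phi>: "\<Phi> Y \<subseteq> V - {v} \<and> {e \<in> E. f e \<in> cut E' Y} = cut E (\<Phi> Y)" for Y
    unfolding \<Phi>_def by (rule someI_ex) (rule cut_preimage_avoiding)
  have "inj_on \<Phi> (Pow (V' - {r'}))"
  proof (rule inj_onI)
    fix S T assume ST: "S \<in> Pow (V' - {r'})" "T \<in> Pow (V' - {r'})" "\<Phi> S = \<Phi> T"
    have "{e \<in> E. f e \<in> cut E' S} = {e \<in> E. f e \<in> cut E' T}" using \<Phi> ST(3) by metis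
    then have "f ` {e \<in> E. f e \<in> cut E' S} = f ` {e \<in> E. f e \<in> cut E' T}" by simp
    moreover have "f ` {e \<in> E. f e \<in> cut E' Y} = cut E' Y" for Y
      using image_E cut_subset[of E' Y] by blast
    ultimately have "cut E' S = cut E' T" by simp
    then show "S = T" using cut_image_inj[of S T r'] ST r' by blast
  qed
  then have "card (\<Phi> ` Pow (V' - {r'})) = card (Pow (V' - {r'}))" by (rule card_image)
  also have "\<dots> \<ge> card (Pow (V - {v}))"
    using card_V_le finite_V finite_V' v r' by (simp add: card_Pow)
  finally have "\<Phi> ` Pow (V' - {r'}) = Pow (V - {v})"
    by (intro card_seteq) (use \<Phi> finite_V in auto)
  \<comment> \<open>The star of \<open>v\<close> is also the cut of \<open>V - {v}\<close>, which is
    the description that misses the base vertex \<open>v\<close>.\<close>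
  then have "V - {v} \<in> \<Phi> ` Pow (V' - {r'})" by simp
  then obtain Y where "\<Phi> Y = V - {v}" by auto
  then have "{e \<in> E. f e \<in> cut E' Y} = cut E (V - {v})" using \<Phi> by metis
  then show ?thesis unfolding cut_compl cut_singleton by blast
qed

text \<open>The graph \<open>G - v\<close> is 2-connected, so its image lies on one side of the cut of \<open>G'\<close> that
  corresponds to the star of \<open>v\<close>; the star of any vertex on the other side pulls back into the star of \<open>v\<close>.\<close>
lemma star_is_star_preimage:
  assumes v: "v \<in> V"
  shows "\<exists>w\<in>V'. star_preimage w = {e \<in> E. v \<in> e}"
proof -
  obtain Y where Y: "{e \<in> E. f e \<in> cut E' Y} = {e \<in> E. v \<in> e}" using star_is_cut_preimage[OF v] by blast
  have "{e \<in> E. v \<in> e} \<noteq> {}" using degree[OF v] by fastforce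
  then obtain e1 where "e1 \<in> E" "f e1 \<in> cut E' Y" using Y by blast
  then have "f e1 \<subseteq> V'" "f e1 \<inter> Y \<noteq> {}" "f e1 - Y \<noteq> {}"
    using edge'_subset[OF f_edge] unfolding cut_def by simp_all
  then have ne: "Y \<inter> V' \<noteq> {}" "V' - Y \<noteq> {}" by blast+
  have "\<exists>e0\<in>E. v \<notin> e0"
  proof (rule ccontr)
    assume "\<not> (\<exists>e0\<in>E. v \<notin> e0)"
    then have all: "\<And>e. e \<in> E \<Longrightarrow> v \<in> e" by blast
    have "V \<noteq> {v}" using card_V by auto
    then obtain u where u: "u \<in> V" "u \<noteq> v" using v by blast
    have "{e \<in> E. u \<in> e} \<subseteq> {{u, v}}"
    proof
      fix e assume e: "e \<in> {e \<in> E. u \<in> e}"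
      then obtain x y where "e = {x, y}" using edgeE by blast
      then show "e \<in> {{u, v}}" using e all[of e] u by auto
    qed
    then have "card {e \<in> E. u \<in> e} \<le> card {{u, v}}" by (rule card_mono[rotated]) simp
    then show False using degree[OF u(1)] by simp
  qed
  then obtain e0 where e0: "e0 \<in> E" "v \<notin> e0" by blast
  then have "f e0 \<notin> cut E' Y" using Y by blast
  then have "f e0 \<inter> Y = {} \<or> f e0 \<subseteq> Y" using f_edge[OF e0(1)] unfolding cut_def by blast
  then obtain T where T: "T \<subseteq> V'" "T \<noteq> {}" "f e0 \<inter> T = {}" "cut E' T = cut E' Y"
  proof
    assume *: "f e0 \<inter> Y = {}"
    have "cut E' (Y \<inter> V') = cut E' Y" using edge'_subset unfolding cut_def by blast
    then show ?thesis by (intro that[of "Y \<inter> V'"]) (use ne * in auto)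
  next
    assume *: "f e0 \<subseteq> Y"
    have "cut E' (V' - Y) = cut E' Y" by (rule cut_complement) (rule edge'_subset)
    then show ?thesis by (intro that[of "V' - Y"]) (use ne * in auto)
  qed
  have side: "f e \<inter> T = {}" if e: "e \<in> E" "v \<notin> e" for e
  proof (cases "e = e0")
    case False
    obtain C where C: "circ E C" "e \<in> C" "e0 \<in> C" "v \<notin> \<Union>C"
      using circ_through_edges_avoiding[OF e(1) e0(1) False e(2) e0(2)] by blast
    have nc: "f ` C \<inter> cut E' T = {}"
    proof (rule ccontr)
      assume "f ` C \<inter> cut E' T \<noteq> {}"
      then obtain g where "g \<in> C" "f g \<in> cut E' Y" using T(4) by blast
      then have "v \<in> g" using Y circ_subset[OF C(1)] by blast
      then show False using \<open>g \<in> C\<close> C(4) by blast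
    qed
    obtain z where z: "z \<in> f e0" using f_edge[OF e0(1)] by (elim edge'E) blast
    show ?thesis
    proof (rule ccontr)
      assume "f e \<inter> T \<noteq> {}"
      then obtain u where u: "u \<in> f e" "u \<in> T" by blast
      have "z \<in> T" by (rule circ_within[OF circ_image[OF C(1)] nc _ _ u(2)]) (use u z C in auto)
      then show False using T(3) z by blast
    qed
  qed (use T in simp)
  obtain w where w: "w \<in> T" using T by blast
  then have wV: "w \<in> V'" using T by blast
  have sub: "star_preimage w \<subseteq> {e \<in> E. v \<in> e}" using side w unfolding star_preimage_def by blast
  obtain e1 where e1: "e1 \<in> star_preimage w" using star_preimage_nonempty[OF wV] by blast
  have "{e \<in> E. v \<in> e} \<subseteq> star_preimage w"
  proof
    fix e2 assume e2: "e2 \<in> {e \<in> E. v \<in> e}"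
    show "e2 \<in> star_preimage w"
    proof (rule ccontr)
      assume n: "e2 \<notin> star_preimage w"
      then have ne: "e1 \<noteq> e2" using e1 by blast
      have e1': "e1 \<in> E" "v \<in> e1" using e1 sub by auto
      obtain C where C: "circ E C" "e1 \<in> C" "e2 \<in> C" using circ_through[of e1 e2] e1' e2 ne by blast
      have fin: "finite C" by (rule circ_finite[OF C(1)])
      \<comment> \<open>A circuit has only two edges at \<open>v\<close>. If just one of them
        belonged to the preimage of the star of \<open>w\<close>, the circuit would meet that
        preimage in one edge, against parity.\<close>
      have "{e1, e2} = {e \<in> C. v \<in> e}"
        by (rule card_seteq) (use fin C e1' e2 ne circ_degree_le[OF C(1), of v] in auto)
      then have "C \<inter> star_preimage w \<subseteq> {e1, e2}" using sub by blast
      then have "C \<inter> star_preimage w = {e1}" using n e1 C by blast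
      then show False using star_preimage_circ_even[OF C(1), of w] by simp
    qed
  qed
  then show ?thesis using sub wV by blast
qed

theorem induced_by_isomorphism:
  "\<exists>\<phi>. bij_betw \<phi> V V' \<and> (\<forall>u v. {u, v} \<in> E \<longrightarrow> f {u, v} = {\<phi> u, \<phi> v})"
proof -
  obtain \<phi> where \<phi>: "\<And>v. v \<in> V \<Longrightarrow> \<phi> v \<in> V'" "\<And>v. v \<in> V \<Longrightarrow> star_preimage (\<phi> v) = {e \<in> E. v \<in> e}"
    using star_is_star_preimage by metis
  have inc: "\<phi> v \<in> f e \<longleftrightarrow> v \<in> e" if "v \<in> V" "e \<in> E" for v e
    using \<phi>(2)[OF that(1)] that(2) unfolding star_preimage_def by blast
  have inj\<phi>: "inj_on \<phi> V"
  proof (rule inj_onI, rule ccontr)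
    fix u v assume uv: "u \<in> V" "v \<in> V" "\<phi> u = \<phi> v" "u \<noteq> v"
    \<comment> \<open>Vertices with the same image are incident with the same edges, so only the
      edge \<open>{u, v}\<close> could contain \<open>u\<close>, against minimum degree
      three.\<close>
    have "{e \<in> E. u \<in> e} \<subseteq> {{u, v}}"
    proof
      fix e assume e: "e \<in> {e \<in> E. u \<in> e}"
      then obtain x y where "e = {x, y}" using edgeE by blast
      moreover have "v \<in> e" using e inc[of u e] inc[of v e] uv by auto
      ultimately show "e \<in> {{u, v}}" using e uv by auto
    qed
    then have "card {e \<in> E. u \<in> e} \<le> card {{u, v}}" by (rule card_mono[rotated]) simp
    then show False using degree[OF uv(1)] by simp
  qed
  have edge: "f {u, v} = {\<phi> u, \<phi> v}" if e: "{u, v} \<in> E" for u v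
  proof -
    have uv: "u \<in> V" "v \<in> V" "u \<noteq> v" using edgeE[OF e] by (auto simp: doubleton_eq_iff)
    then have "\<phi> u \<noteq> \<phi> v" using inj\<phi> by (auto dest: inj_onD)
    moreover have "\<phi> u \<in> f {u, v}" "\<phi> v \<in> f {u, v}" using inc e uv by auto
    moreover obtain x y where "f {u, v} = {x, y}" using f_edge[OF e] by (elim edge'E)
    ultimately show ?thesis by auto
  qed
  have "V' \<subseteq> \<phi> ` V"
  proof
    fix w assume "w \<in> V'"
    then obtain e where e: "e \<in> E" "w \<in> f e" using star_preimage_nonempty unfolding star_preimage_def by blast
    obtain u v where uv: "e = {u, v}" "u \<in> V" "v \<in> V" by (rule edgeE[OF e(1)])
    then show "w \<in> \<phi> ` V" using e edge[of u v] by auto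
  qed
  then have "bij_betw \<phi> V V'" unfolding bij_betw_def using inj\<phi> \<phi>(1) by blast
  then show ?thesis using edge by blast
qed

end

theorem theorem1p2:
  fixes V :: "'a set" and E :: "'a set set" and V' :: "'b set" and E' :: "'b set set"
    and f :: "'a set \<Rightarrow> 'b set"
  assumes "simple_graph V E" and "finite V" and "k_connected 3 V E"
    and "simple_graph V' E'" and "no_isolated_vertices V' E'"
    and "circuit_surjection V E V' E' f"
  shows "\<exists>\<phi>. bij_betw \<phi> V V' \<and> (\<forall>u v. {u, v} \<in> E \<longrightarrow> f {u, v} = {\<phi> u, \<phi> v})"
proof -
  interpret circuit_map V E V' E' f
    by unfold_locales fact+
  show ?thesis by (rule induced_by_isomorphism)
qed

end
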